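(* Let $\varepsilon>0$ and let $\{z^t\}_{t\ge0}$ be the sequence generated by Stochastic Amplitude Flow, $z^{t+1}=z^t-\mu_t\,g_\varepsilon(z^t)$, with an arbitrary starting point $z^0\in\mathbb C^d$. Suppose the step sizes $\mu_t$ are positive and satisfy $$\sum_{t=0}^\infty\mu_t=\infty,\qquad\sum_{t=0}^\infty\mu_t^2<\infty,\qquad\beta\|A\|^2\mu_t\le1\ \text{ for all }t\ge0 .$$ Then $$\lim_{t\to\infty}\|\nabla_z\mathcal L_\varepsilon(z^t)\|_2=0\quad\text{almost surely.}$$
   Context: Let $A\in\mathbb C^{m\times d}$ and $y\in[0,\infty)^m$ (phase retrieval measurements $y=|Ax|^2+n$ of an unknown $x\in\mathbb C^d$ with perturbation $n\in\mathbb R^m$). Functions such as $|\cdot|$, square, square root and addition of a constant act entrywise on vectors; $\circ$ and $/$ between vectors are entrywise product and division. $\|\cdot\|$ is the spectral norm of a matrix. For $\varepsilon>0$ the loss is $\mathcal L_\varepsilon(z)=\|\sqrt{|Az|^2+\varepsilon}-\sqrt{y+\varepsilon}\|_2^2$, $z\in\mathbb C^d$, with Wirtinger gradient $\nabla_z\mathcal L_\varepsilon(z)=A^*(Az-\sqrt{y+\varepsilon}\circ Az/\sqrt{|Az|^2+\varepsilon})$. Partition the rows of $A$ into $R$ blocks $A_1,\dots,A_R$ ($1\le R\le m$), with $y^1,\dots,y^R$ the corresponding blocks of $y$. Let $\mathcal L_{\varepsilon,r}(z)=\|\sqrt{|A_rz|^2+\varepsilon}-\sqrt{y^r+\varepsilon}\|_2^2$,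 so $\mathcal L_\varepsilon=\sum_{r=1}^R\mathcal L_{\varepsilon,r}$; $\nabla_z\mathcal L_{\varepsilon,r}$ is defined by the same formula with $(A_r,y^r)$ in place of $(A,y)$. Let $p$ be a probability distribution on $\{1,\dots,R\}$ with $0<p_r<1$ for all $r$ and $\sum_r p_r=1$, and let $K\in\mathbb N$, $K\ge1$. The stochastic gradient is $g_\varepsilon(z)=\frac1K\sum_{k=1}^K\frac{1}{p_{r_k}}\nabla_z\mathcal L_{\varepsilon,r_k}(z)$, where $r_1,\dots,r_K$ are drawn independently with replacement from $p$; in Stochastic Amplitude Flow fresh indices, independent of all previous ones, are drawn at every iteration $t$. The constant $\beta$ is $\beta=1-\frac1K$. *)

theory Defs
  imports "HOL-Probability.Probability"
begin

text \<open>
  The blocks \<open>A\<^sub>r\<close> have different numbers of rows, so they do not share a matrix type.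
  Loss and gradient therefore take the set \<open>S\<close> of rows in use: \<open>S = UNIV\<close> gives the
  data \<open>(A, y)\<close>, and the rows \<open>S\<close> of block \<open>r\<close> give \<open>(A\<^sub>r, y\<^sup>r)\<close>.
\<close>

definition amp_loss ::
  "complex ^ 'd ^ 'm \<Rightarrow> real ^ 'm \<Rightarrow> real \<Rightarrow> 'm set \<Rightarrow> complex ^ 'd \<Rightarrow> real"
  where "amp_loss A y \<epsilon> S z =
    (\<Sum>i\<in>S. (sqrt ((cmod ((A *v z) $ i))\<^sup>2 + \<epsilon>) - sqrt (y $ i + \<epsilon>))\<^sup>2)"

text \<open>
  The Wirtinger gradient \<open>A\<^sub>S\<^sup>* (A\<^sub>S z - sqrt (y\<^sub>S + \<epsilon>) \<circ> A\<^sub>S z / sqrt (|A\<^sub>S z|\<^sup>2 + \<epsilon>))\<close>,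
  with the product by the conjugate transpose written out.
\<close>

definition amp_grad ::
  "complex ^ 'd ^ 'm \<Rightarrow> real ^ 'm \<Rightarrow> real \<Rightarrow> 'm set \<Rightarrow> complex ^ 'd \<Rightarrow> complex ^ 'd"
  where "amp_grad A y \<epsilon> S z =
    (\<chi> j. \<Sum>i\<in>S. cnj (A $ i $ j) *
      ((A *v z) $ i - complex_of_real (sqrt (y $ i + \<epsilon>)) * (A *v z) $ i
          / complex_of_real (sqrt ((cmod ((A *v z) $ i))\<^sup>2 + \<epsilon>))))"

definition block_rows :: "('m \<Rightarrow> 'r) \<Rightarrow> 'r \<Rightarrow> 'm set"
  where "block_rows blk r = {i. blk i = r}"

definition stoch_grad ::
  "complex ^ 'd ^ 'm \<Rightarrow> real ^ 'm \<Rightarrow> real \<Rightarrow> ('m \<Rightarrow> 'r) \<Rightarrow> 'r pmf \<Rightarrow> nat \<Rightarrow> (nat \<Rightarrow> 'r)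
    \<Rightarrow> complex ^ 'd \<Rightarrow> complex ^ 'd"
  where "stoch_grad A y \<epsilon> blk p K r z =
    (1 / real K) *\<^sub>R
      (\<Sum>k=1..K. (1 / pmf p (r k)) *\<^sub>R amp_grad A y \<epsilon> (block_rows blk (r k)) z)"

lemma amp_loss_UNIV:
  "amp_loss A y \<epsilon> UNIV z =
    (norm ((\<chi> i. sqrt ((cmod ((A *v z) $ i))\<^sup>2 + \<epsilon>)) - (\<chi> i. sqrt (y $ i + \<epsilon>)) :: real ^ 'm))\<^sup>2"
  by (simp add: amp_loss_def norm_vec_def L2_set_def sum_nonneg)

lemma amp_loss_blocks:
  fixes blk :: "'m::finite \<Rightarrow> 'r::finite"
  shows "amp_loss A y \<epsilon> UNIV z = (\<Sum>r\<in>UNIV. amp_loss A y \<epsilon> (block_rows blk r) z)"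
  unfolding amp_loss_def block_rows_def
  by (rule sum.group[of "UNIV :: 'm set" "UNIV :: 'r set" blk, simplified, symmetric])

lemma amp_grad_UNIV:
  "amp_grad A y \<epsilon> UNIV z = (\<chi> j i. cnj (A $ i $ j)) *v
    (\<chi> i. (A *v z) $ i - complex_of_real (sqrt (y $ i + \<epsilon>)) * (A *v z) $ i
          / complex_of_real (sqrt ((cmod ((A *v z) $ i))\<^sup>2 + \<epsilon>)))"
  by (simp add: amp_grad_def matrix_vector_mult_def vec_eq_iff)

text \<open>
  The gradient with respect to the real inner product on \<open>complex ^ 'd\<close> is \<open>\<partial>\<^sub>x f + \<i> \<partial>\<^sub>y f\<close>,
  twice the Wirtinger gradient \<open>(\<partial>\<^sub>x f + \<i> \<partial>\<^sub>y f) / 2\<close>.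
\<close>

lemma amp_loss_gderiv:
  fixes A :: "complex ^ 'd ^ 'm"
  assumes "\<epsilon> > 0"
  shows "GDERIV (amp_loss A y \<epsilon> S) z :> 2 *\<^sub>R amp_grad A y \<epsilon> S z"
proof -
  define q where "q i = sqrt ((cmod ((A *v z) $ i))\<^sup>2 + \<epsilon>)" for i
  have pos: "0 < (cmod ((A *v w) $ i))\<^sup>2 + \<epsilon>" for w i
    using assms by (simp add: add_nonneg_pos)
  have q: "q i > 0" for i
    unfolding q_def using pos by simp
  have lin: "((\<lambda>w. (A *v w) $ i) has_derivative (\<lambda>h. (A *v h) $ i)) (at z)" for i
    unfolding matrix_vector_mult_def
    by (auto intro!: derivative_eq_intros bounded_linear.has_derivative[OF bounded_linear_vec_nth])
  have one: "((\<lambda>w. (sqrt ((cmod ((A *v w) $ i))\<^sup>2 + \<epsilon>) - sqrt (y $ i + \<epsilon>))\<^sup>2) has_derivative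
      (\<lambda>h. 2 * (1 - sqrt (y $ i + \<epsilon>) / q i) * (((A *v z) $ i) \<bullet> ((A *v h) $ i)))) (at z)" for i
  proof -
    have sq: "((\<lambda>w. (cmod ((A *v w) $ i))\<^sup>2) has_derivative
        (\<lambda>h. 2 * (((A *v z) $ i) \<bullet> ((A *v h) $ i)))) (at z)"
      unfolding power2_norm_eq_inner
      by (rule has_derivative_eq_rhs[OF has_derivative_inner[OF lin lin]])
         (auto simp: inner_commute)
    have rt: "((\<lambda>w. sqrt ((cmod ((A *v w) $ i))\<^sup>2 + \<epsilon>)) has_derivative
        (\<lambda>h. (((A *v z) $ i) \<bullet> ((A *v h) $ i)) / q i)) (at z)"
      by (rule has_derivative_eq_rhs[OF has_derivative_real_sqrt[OF pos has_derivative_add[OF sq has_derivative_const]]])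
         (auto simp: q_def field_simps)
    show ?thesis
      by (rule has_derivative_eq_rhs[OF has_derivative_power[OF has_derivative_diff[OF rt has_derivative_const]]])
         (use q[of i] in \<open>auto simp: q_def[of i, symmetric, unfolded add.commute[of _ \<epsilon>]] field_simps\<close>)
  qed
  have in1: "(c::complex) \<bullet> d = Re (cnj c * d)" for c d
    by (simp add: inner_complex_def)
  have grad: "amp_grad A y \<epsilon> S z \<bullet> h =
      (\<Sum>i\<in>S. (1 - sqrt (y $ i + \<epsilon>) / q i) * (((A *v z) $ i) \<bullet> ((A *v h) $ i)))" for h
  proof -
    define v where "v i = (A *v z) $ i - sqrt (y $ i + \<epsilon>) * (A *v z) $ i / q i" for i
    have "amp_grad A y \<epsilon> S z \<bullet> h = (\<Sum>j\<in>UNIV. \<Sum>i\<in>S. Re (A $ i $ j * cnj (v i) * h $ j))"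
      unfolding inner_vec_def amp_grad_def in1 v_def q_def
      by (simp only: vec_lambda_beta cnj_sum complex_cnj_mult complex_cnj_cnj sum_distrib_right Re_sum)
    also have "\<dots> = (\<Sum>i\<in>S. \<Sum>j\<in>UNIV. Re (A $ i $ j * cnj (v i) * h $ j))"
      by (rule sum.swap)
    also have "\<dots> = (\<Sum>i\<in>S. Re (cnj (v i) * (A *v h) $ i))"
      unfolding matrix_vector_mult_def
      by (simp only: vec_lambda_beta sum_distrib_left Re_sum mult.assoc mult.left_commute)
    finally have "amp_grad A y \<epsilon> S z \<bullet> h = (\<Sum>i\<in>S. Re (cnj (v i) * (A *v h) $ i))" .
    also have "\<dots> = (\<Sum>i\<in>S. (1 - sqrt (y $ i + \<epsilon>) / q i) * (((A *v z) $ i) \<bullet> ((A *v h) $ i)))"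
    proof (rule sum.cong[OF refl])
      fix i
      have "(A *v z) $ i - sqrt (y $ i + \<epsilon>) * (A *v z) $ i / q i =
          complex_of_real (1 - sqrt (y $ i + \<epsilon>) / q i) * (A *v z) $ i"
        by (simp add: algebra_simps)
      then show "Re (cnj (v i) * (A *v h) $ i) =
          (1 - sqrt (y $ i + \<epsilon>) / q i) * (((A *v z) $ i) \<bullet> ((A *v h) $ i))"
        by (simp only: v_def in1 complex_cnj_mult complex_cnj_complex_of_real mult.assoc)
           simp
    qed
    finally show ?thesis .
  qed
  have "(amp_loss A y \<epsilon> S has_derivative (\<lambda>h. \<Sum>i\<in>S.
      2 * (1 - sqrt (y $ i + \<epsilon>) / q i) * (((A *v z) $ i) \<bullet> ((A *v h) $ i)))) (at z)"
    unfolding amp_loss_def[abs_def] by (rule has_derivative_sum[OF one])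
  then show ?thesis
    unfolding gderiv_def
    by (rule has_derivative_eq_rhs) (auto simp: inner_commute[of _ "amp_grad A y \<epsilon> S z"] grad sum_distrib_left algebra_simps)
qed

end

theory Submission
  imports Defs
begin

text \<open>
  Write \<open>L\<close> for the loss, \<open>G\<close> for its Wirtinger gradient and \<open>g\<close> for the stochastic gradient. The
  decrease of \<open>L\<close> rests on two of its properties. Since \<open>v \<mapsto> sqrt (|v|\<^sup>2 + \<epsilon>)\<close> is convex and enters \<open>L\<close> with a negative
  coefficient, \<open>L\<close> lies below a quadratic with the curvature of \<open>|A z|\<^sup>2\<close> (\<open>amp_loss_descent\<close>):
  \<open>L (z + h) \<le> L z + 2 \<langle>G z, h\<rangle> + \<parallel>A\<parallel>\<^sup>2 \<parallel>h\<parallel>\<^sup>2\<close>. And each block gradient is at most \<open>\<parallel>A\<parallel> sqrt (L z)\<close>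
  (\<open>norm_amp_grad_le_sqrt_loss\<close>).

  For a mean of \<open>K\<close> independent unbiased samples, \<open>E \<parallel>g\<parallel>\<^sup>2\<close> is \<open>1/K\<close> times the second moment of one
  sample plus \<open>(1 - 1/K) \<parallel>G\<parallel>\<^sup>2\<close> (\<open>sample_mean_norm_expectation\<close>). In the expectation of the quadratic
  bound at \<open>h = - \<mu> g\<close>, the condition \<open>(1 - 1/K) \<parallel>A\<parallel>\<^sup>2 \<mu> \<le> 1\<close> lets half of the descent \<open>- 2 \<mu> \<parallel>G\<parallel>\<^sup>2\<close>
  pay for the second part; the first part is at most a constant times \<open>\<mu>\<^sup>2 L\<close>. Hence
  (\<open>expected_loss_decrease\<close>) \<open>E L (z - \<mu> g) + \<mu> \<parallel>G z\<parallel>\<^sup>2 \<le> (1 + c \<mu>\<^sup>2) L z\<close>. The indices drawn at time \<open>t\<close>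
  are independent of the past, of which \<open>z\<^sub>t\<close> is a function, so this inequality
  holds conditionally on the past.

  Up to summable factors \<open>L (z\<^sub>t)\<close> is therefore a nonnegative supermartingale. Telescoping the
  expectations shows that \<open>\<Sum> \<mu>\<^sub>t \<parallel>G (z\<^sub>t)\<parallel>\<^sup>2\<close> is finite almost surely, and a maximal inequality
  shows that \<open>L (z\<^sub>t)\<close> is bounded almost surely (\<open>almost_supermartingale_summable\<close>,
  \<open>almost_supermartingale_bounded\<close>).

  Along a path on which both hold, the stochastic gradients are bounded, and as \<open>G\<close> is
  Lipschitz, \<open>\<parallel>G (z\<^sub>t)\<parallel>\<close> changes by at most a constant times \<open>\<mu>\<^sub>t\<close> in a step. Together with
  \<open>\<Sum> \<mu>\<^sub>t \<parallel>G (z\<^sub>t)\<parallel>\<^sup>2 < \<infinity>\<close> and \<open>\<Sum> \<mu>\<^sub>t = \<infinity>\<close> this forces \<open>\<parallel>G (z\<^sub>t)\<parallel> \<longlonglongrightarrow> 0\<close>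
  (\<open>tendsto_zero_if_weighted_squares_summable\<close>).
\<close>

section \<open>Sequences with small increments\<close>

text \<open>
  Summability of \<open>\<mu>\<^sub>t a\<^sub>t\<^sup>2\<close> with divergent \<open>\<Sum> \<mu>\<^sub>t\<close> only gives \<open>liminf a = 0\<close>. The increment bound
  excludes oscillation because the cubes \<open>a\<^sub>t\<^sup>3\<close> have increments of order \<open>\<mu>\<^sub>t a\<^sub>t\<^sup>2 + \<mu>\<^sub>t\<^sup>3\<close>, which
  are absolutely summable. So \<open>a\<^sub>t\<^sup>3\<close> converges, and a positive limit would make \<open>\<Sum> \<mu>\<^sub>t\<close> finite.
\<close>

lemma tendsto_zero_if_weighted_squares_summable:
  fixes a \<mu> :: "nat \<Rightarrow> real"
  assumes a_nonneg: "\<And>t. 0 \<le> a t" and mu_nonneg: "\<And>t. 0 \<le> \<mu> t"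
    and mu_div: "\<not> summable \<mu>" and mu_sq: "summable (\<lambda>t. (\<mu> t)\<^sup>2)"
    and weighted: "summable (\<lambda>t. \<mu> t * (a t)\<^sup>2)"
    and slow: "\<And>t. \<bar>a (Suc t) - a t\<bar> \<le> C * \<mu> t"
  shows "a \<longlonglongrightarrow> 0"
proof -
  \<comment> \<open>The monotonicity steps below need a nonnegative constant.\<close>
  define D where "D = max C 0"
  have D: "0 \<le> D" "\<bar>a (Suc t) - a t\<bar> \<le> D * \<mu> t" for t
    using slow[of t] mult_right_mono[of C D "\<mu> t"] mu_nonneg[of t] by (auto simp: D_def)
  have incr: "\<bar>a (Suc t) ^ 3 - a t ^ 3\<bar> \<le> 6 * D * (\<mu> t * (a t)\<^sup>2) + 6 * D ^ 3 * \<mu> t ^ 3" for t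
  proof -
    let ?b = "a t + D * \<mu> t"
    have b: "a t \<le> ?b" "a (Suc t) \<le> ?b" "0 \<le> ?b"
      using D(1) D(2)[of t] a_nonneg[of t] mu_nonneg[of t] by (auto simp: abs_le_iff)
    have "\<bar>a (Suc t) ^ 3 - a t ^ 3\<bar> =
        \<bar>a (Suc t) - a t\<bar> * (a (Suc t) * a (Suc t) + a (Suc t) * a t + a t * a t)"
    proof -
      have "a (Suc t) ^ 3 - a t ^ 3 =
        (a (Suc t) - a t) * (a (Suc t) * a (Suc t) + a (Suc t) * a t + a t * a t)"
        by (simp add: algebra_simps power3_eq_cube)
      then show ?thesis
        using a_nonneg by (simp add: abs_mult)
    qed
    also have "\<dots> \<le> (D * \<mu> t) * (?b * ?b + ?b * ?b + ?b * ?b)"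
      using D b a_nonneg mu_nonneg by (intro mult_mono add_mono) auto
    also have "\<dots> = 3 * (D * \<mu> t) * ?b\<^sup>2"
      by (simp add: power2_eq_square)
    also have "\<dots> \<le> 3 * (D * \<mu> t) * (2 * (a t)\<^sup>2 + 2 * (D * \<mu> t)\<^sup>2)"
    proof (rule mult_left_mono)
      show "?b\<^sup>2 \<le> 2 * (a t)\<^sup>2 + 2 * (D * \<mu> t)\<^sup>2"
        using sum_squares_bound[of "a t" "D * \<mu> t"] by (simp add: power2_sum)
    qed (use D mu_nonneg in auto)
    also have "\<dots> = 6 * D * (\<mu> t * (a t)\<^sup>2) + 6 * D ^ 3 * \<mu> t ^ 3"
      by (simp add: algebra_simps power2_eq_square power3_eq_cube)
    finally show ?thesis .
  qed
  have cube: "summable (\<lambda>t. \<mu> t ^ 3)"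
  proof (rule summable_comparison_test_ev[OF _ mu_sq])
    have "(\<lambda>t. sqrt ((\<mu> t)\<^sup>2)) \<longlonglongrightarrow> sqrt 0"
      by (intro tendsto_real_sqrt summable_LIMSEQ_zero mu_sq)
    then have "\<mu> \<longlonglongrightarrow> 0"
      using mu_nonneg by simp
    then have "\<forall>\<^sub>F t in sequentially. \<mu> t < 1"
      by (rule order_tendstoD) simp
    then show "\<forall>\<^sub>F t in sequentially. norm (\<mu> t ^ 3) \<le> (\<mu> t)\<^sup>2"
    proof eventually_elim
      case (elim t)
      then show ?case
        using mu_nonneg[of t] power_decreasing[of 2 3 "\<mu> t"] by simp
    qed
  qed
  have "summable (\<lambda>t. a (Suc t) ^ 3 - a t ^ 3)"
    by (rule summable_comparison_test'[OF summable_add[OF summable_mult[OF weighted, of "6 * D"]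
          summable_mult[OF cube, of "6 * D ^ 3"]]]) (use incr in auto)
  then have "(\<lambda>n. \<Sum>t<n. a (Suc t) ^ 3 - a t ^ 3) \<longlonglongrightarrow> (\<Sum>t. a (Suc t) ^ 3 - a t ^ 3)"
    by (rule summable_LIMSEQ)
  then have "(\<lambda>n. a n ^ 3 - a 0 ^ 3) \<longlonglongrightarrow> (\<Sum>t. a (Suc t) ^ 3 - a t ^ 3)"
    by (simp only: sum_lessThan_telescope[of "\<lambda>t. a t ^ 3"])
  from tendsto_add[OF this tendsto_const[of "a 0 ^ 3"]]
  obtain l where "(\<lambda>n. a n ^ 3) \<longlonglongrightarrow> l"
    by auto
  then have "(\<lambda>n. root 3 (a n ^ 3)) \<longlonglongrightarrow> root 3 l"
    by (rule tendsto_real_root)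
  then have lim: "a \<longlonglongrightarrow> root 3 l"
    using a_nonneg by (simp add: real_root_power_cancel)
  have "root 3 l \<le> 0"
  proof (rule ccontr)
    define m where "m = root 3 l / 2"
    assume "\<not> root 3 l \<le> 0"
    then have m: "0 < m" "m < root 3 l"
      by (auto simp: m_def)
    have "\<forall>\<^sub>F t in sequentially. norm (\<mu> t) \<le> (1 / m\<^sup>2) * (\<mu> t * (a t)\<^sup>2)"
      using order_tendstoD(1)[OF lim m(2)]
    proof eventually_elim
      case (elim t)
      have "\<mu> t * m\<^sup>2 \<le> \<mu> t * (a t)\<^sup>2"
        using elim m(1) mu_nonneg by (intro mult_left_mono power_mono) auto
      then show ?case
        using m(1) mu_nonneg[of t] by (simp add: field_simps)
    qed
    then have "summable \<mu>"
      by (rule summable_comparison_test_ev[OF _ summable_mult[OF weighted]])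
    with mu_div show False ..
  qed
  moreover have "0 \<le> root 3 l"
    using lim a_nonneg by (intro LIMSEQ_le_const) auto
  ultimately show ?thesis
    using lim by simp
qed

section \<open>Nonnegative almost-supermartingales\<close>

text \<open>
  A weak form of the Robbins--Siegmund theorem. The drift hypothesis is the conditional inequality
  \<open>E (X\<^sub>t\<^sub>+\<^sub>1 + H\<^sub>t | F\<^sub>t) \<le> (1 + c\<^sub>t) X\<^sub>t\<close>, integrated over the events of \<open>F\<^sub>t\<close>; with values in \<open>ennreal\<close>
  all these integrals exist. Both conclusions come from the bound
  \<open>w\<^sub>n = (1 + c\<^sub>0) \<dots> (1 + c\<^sub>n\<^sub>-\<^sub>1) \<le> exp (\<Sum> c)\<close> for the accumulated growth: summability from the drift over
  the whole space, boundedness from the drift over the events where \<open>X\<close> has not yet exceeded a level \<open>l\<close>,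
  which is Ville's maximal inequality.
\<close>

lemma almost_supermartingale:
  fixes X H :: "nat \<Rightarrow> 'w \<Rightarrow> ennreal" and c :: "nat \<Rightarrow> real" and F :: "nat \<Rightarrow> 'w measure"
  assumes sub: "\<And>t. subalgebra M (F t)" and mono: "\<And>t. sets (F t) \<subseteq> sets (F (Suc t))"
    and X_meas: "\<And>t. X t \<in> borel_measurable (F t)"
    and H_meas: "\<And>t. H t \<in> borel_measurable M"
    and c_nonneg: "\<And>t. 0 \<le> c t" and c_sum: "summable c"
    and drift: "\<And>t B. B \<in> sets (F t) \<Longrightarrow>
      (\<integral>\<^sup>+\<omega>\<in>B. X (Suc t) \<omega> \<partial>M) + (\<integral>\<^sup>+\<omega>\<in>B. H t \<omega> \<partial>M) \<le> ennreal (1 + c t) * (\<integral>\<^sup>+\<omega>\<in>B. X t \<omega> \<partial>M)"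
    and init: "(\<integral>\<^sup>+\<omega>. X 0 \<omega> \<partial>M) < \<infinity>"
  shows almost_supermartingale_summable: "AE \<omega> in M. (\<Sum>t. H t \<omega>) < \<infinity>"
    and almost_supermartingale_bounded: "AE \<omega> in M. (SUP t. X t \<omega>) < \<infinity>"
proof -
  define w where "w n = (\<Prod>t<n. 1 + c t)" for n
  define W where "W = exp (suminf c)"
  have w_Suc: "ennreal (w (Suc n)) = ennreal (1 + c n) * ennreal (w n)" for n
    using c_nonneg by (subst ennreal_mult[symmetric]) (auto simp: w_def prod_nonneg mult.commute add_nonneg_nonneg)
  have w_le: "ennreal (w n) \<le> ennreal W" for n
  proof (rule ennreal_leI)
    have "w n \<le> exp (\<Sum>t<n. c t)"
      unfolding w_def exp_sum[OF finite_lessThan] using c_nonneg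
      by (intro prod_mono) (auto intro: add_nonneg_nonneg)
    also have "\<dots> \<le> W"
      unfolding W_def using sum_le_suminf[OF c_sum] c_nonneg by auto
    finally show "w n \<le> W" .
  qed
  have one_le: "x \<le> ennreal (1 + c t) * x" for x t
  proof -
    have "1 * x \<le> ennreal (1 + c t) * x"
      by (intro mult_right_mono) (use c_nonneg[of t] in \<open>simp_all flip: ennreal_1\<close>)
    then show ?thesis by simp
  qed
  have finite_bound: "ennreal W * (\<integral>\<^sup>+\<omega>. X 0 \<omega> \<partial>M) < \<infinity>"
    using init by (simp add: ennreal_mult_less_top)
  have space_F: "space (F t) = space M" for t
    using sub by (simp add: subalgebra_def)
  have X_M[measurable]: "X t \<in> borel_measurable M" for t
    by (rule measurable_from_subalg[OF sub X_meas])
  note H_meas[measurable]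

  show "AE \<omega> in M. (\<Sum>t. H t \<omega>) < \<infinity>"
  proof -
    have "(\<integral>\<^sup>+\<omega>. X n \<omega> \<partial>M) + (\<Sum>t<n. \<integral>\<^sup>+\<omega>. H t \<omega> \<partial>M) \<le> ennreal (w n) * (\<integral>\<^sup>+\<omega>. X 0 \<omega> \<partial>M)" for n
    proof (induction n)
      case 0
      then show ?case by (simp add: w_def)
    next
      case (Suc n)
      have "space M \<in> sets (F n)"
        using sets.top[of "F n"] by (simp add: space_F)
      from drift[OF this] have "(\<integral>\<^sup>+\<omega>. X (Suc n) \<omega> \<partial>M) + (\<integral>\<^sup>+\<omega>. H n \<omega> \<partial>M) \<le> ennreal (1 + c n) * (\<integral>\<^sup>+\<omega>. X n \<omega> \<partial>M)"
        by simp
      then have "(\<integral>\<^sup>+\<omega>. X (Suc n) \<omega> \<partial>M) + (\<Sum>t<Suc n. \<integral>\<^sup>+\<omega>. H t \<omega> \<partial>M)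
          \<le> ennreal (1 + c n) * (\<integral>\<^sup>+\<omega>. X n \<omega> \<partial>M) + ennreal (1 + c n) * (\<Sum>t<n. \<integral>\<^sup>+\<omega>. H t \<omega> \<partial>M)"
        using add_mono[OF _ one_le[of "\<Sum>t<n. \<integral>\<^sup>+\<omega>. H t \<omega> \<partial>M" n]] by (fastforce simp: add_ac)
      also have "\<dots> \<le> ennreal (1 + c n) * (ennreal (w n) * (\<integral>\<^sup>+\<omega>. X 0 \<omega> \<partial>M))"
        unfolding distrib_left[symmetric] by (intro mult_left_mono Suc.IH) simp
      finally show ?case
        by (simp add: w_Suc mult.assoc)
    qed
    then have "(\<Sum>t<n. \<integral>\<^sup>+\<omega>. H t \<omega> \<partial>M) \<le> ennreal W * (\<integral>\<^sup>+\<omega>. X 0 \<omega> \<partial>M)" for n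
      using mult_right_mono[OF w_le, of "\<integral>\<^sup>+\<omega>. X 0 \<omega> \<partial>M" n]
      by (meson add_increasing order_trans zero_le order_refl)
    then have "(\<Sum>t. \<integral>\<^sup>+\<omega>. H t \<omega> \<partial>M) \<le> ennreal W * (\<integral>\<^sup>+\<omega>. X 0 \<omega> \<partial>M)"
      by (intro suminf_le_const summableI)
    then have "(\<integral>\<^sup>+\<omega>. (\<Sum>t. H t \<omega>) \<partial>M) < \<infinity>"
      using finite_bound by (simp add: nn_integral_suminf)
    then have "AE \<omega> in M. (\<Sum>t. H t \<omega>) \<noteq> \<infinity>"
      by (intro nn_integral_noteq_infinite) auto
    then show ?thesis
      by eventually_elim (simp add: less_top)
  qed

  show "AE \<omega> in M. (SUP t. X t \<omega>) < \<infinity>"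
  proof -
    define B where "B l n = {\<omega>\<in>space M. \<exists>s<n. X s \<omega> > l}" for l :: ennreal and n
    have B_F: "B l (Suc n) \<in> sets (F n)" for l n
    proof -
      have meas: "{\<omega>\<in>space M. X s \<omega> > l} \<in> sets (F s)" for s
        using X_meas[of s] measurable_sets[of "X s" "F s" borel "{l<..}"]
        by (simp add: space_F vimage_def Int_def conj_commute)
      have "sets (F s) \<subseteq> sets (F n)" if "s \<le> n" for s
        using that mono by (rule lift_Suc_mono_le[rotated])
      then have "(\<Union>s\<in>{..n}. {\<omega>\<in>space M. X s \<omega> > l}) \<in> sets (F n)"
        using meas by (intro sets.finite_UN) auto
      moreover have "B l (Suc n) = (\<Union>s\<in>{..n}. {\<omega>\<in>space M. X s \<omega> > l})"
        by (auto simp: B_def less_Suc_eq_le)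
      ultimately show ?thesis by simp
    qed
    have B_M[measurable]: "B l n \<in> sets M" for l n
      unfolding B_def by measurable
    \<comment> \<open>On first exceeding \<open>l\<close>, the mass \<open>l\<close> times the probability of doing so is split off from the integral of \<open>X\<close>.\<close>
    have ville: "l * emeasure M (B l n) \<le> ennreal (w n) * (\<integral>\<^sup>+\<omega>. X 0 \<omega> \<partial>M)" for l n
    proof -
      have "(\<integral>\<^sup>+\<omega>\<in>space M - B l n. X n \<omega> \<partial>M) + l * emeasure M (B l n)
          \<le> ennreal (w n) * (\<integral>\<^sup>+\<omega>. X 0 \<omega> \<partial>M)"
      proof (induction n)
        case 0
        then show ?case by (simp add: w_def B_def)
      next
        case (Suc n)
        let ?N = "B l (Suc n) - B l n"
        have subs: "B l n \<subseteq> B l (Suc n)"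
          unfolding B_def by (auto intro: less_SucI)
        have em: "emeasure M (B l (Suc n)) = emeasure M ?N + emeasure M (B l n)"
          using subs by (subst plus_emeasure) (auto intro!: arg_cong[where f="emeasure M"])
        have new: "l * emeasure M ?N \<le> (\<integral>\<^sup>+\<omega>\<in>?N. X n \<omega> \<partial>M)"
        proof -
          have "l * emeasure M ?N = (\<integral>\<^sup>+\<omega>. l * indicator ?N \<omega> \<partial>M)"
            by (simp add: nn_integral_cmult)
          also have "\<dots> \<le> (\<integral>\<^sup>+\<omega>\<in>?N. X n \<omega> \<partial>M)"
            by (intro nn_integral_mono) (auto simp: B_def less_Suc_eq indicator_def)
          finally show ?thesis .
        qed
        have split: "(\<integral>\<^sup>+\<omega>\<in>space M - B l (Suc n). X n \<omega> \<partial>M) + (\<integral>\<^sup>+\<omega>\<in>?N. X n \<omega> \<partial>M)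
            = (\<integral>\<^sup>+\<omega>\<in>space M - B l n. X n \<omega> \<partial>M)"
          using subs by (subst nn_integral_add[symmetric])
            (auto intro!: nn_integral_cong simp: indicator_def)
        have "space M - B l (Suc n) \<in> sets (F n)"
          using B_F[of l n] sets.compl_sets[of _ "F n"] by (simp add: space_F)
        from drift[OF this] have "(\<integral>\<^sup>+\<omega>\<in>space M - B l (Suc n). X (Suc n) \<omega> \<partial>M)
            \<le> ennreal (1 + c n) * (\<integral>\<^sup>+\<omega>\<in>space M - B l (Suc n). X n \<omega> \<partial>M)"
          by (meson add_increasing2 order_trans zero_le order_refl)
        then have "(\<integral>\<^sup>+\<omega>\<in>space M - B l (Suc n). X (Suc n) \<omega> \<partial>M) + l * emeasure M (B l (Suc n))
            \<le> ennreal (1 + c n) * (\<integral>\<^sup>+\<omega>\<in>space M - B l (Suc n). X n \<omega> \<partial>M)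
              + ennreal (1 + c n) * ((\<integral>\<^sup>+\<omega>\<in>?N. X n \<omega> \<partial>M) + l * emeasure M (B l n))"
          unfolding em distrib_left[of l]
          by (rule add_mono[OF _ order_trans[OF add_mono[OF new order_refl] one_le]])
        also have "\<dots> = ennreal (1 + c n) *
            ((\<integral>\<^sup>+\<omega>\<in>space M - B l n. X n \<omega> \<partial>M) + l * emeasure M (B l n))"
          unfolding split[symmetric] by (simp add: distrib_left add.assoc)
        also have "\<dots> \<le> ennreal (1 + c n) * (ennreal (w n) * (\<integral>\<^sup>+\<omega>. X 0 \<omega> \<partial>M))"
          by (intro mult_left_mono Suc.IH) simp
        finally show ?case
          by (simp add: w_Suc mult.assoc)
      qed
      then show ?thesis
        by (meson add_increasing order_trans zero_le order_refl)
    qed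
    define E where "E = (\<integral>\<^sup>+\<omega>. X 0 \<omega> \<partial>M)"
    define Z where "Z = {\<omega>\<in>space M. (SUP t. X t \<omega>) = \<infinity>}"
    have Z_M: "Z \<in> sets M"
      unfolding Z_def by measurable
    have bound: "l * emeasure M Z \<le> ennreal W * E" if "l < \<infinity>" for l
    proof -
      have "emeasure M Z \<le> emeasure M (\<Union>n. B l n)"
      proof (rule emeasure_mono)
        show "Z \<subseteq> (\<Union>n. B l n)"
        proof
          fix \<omega> assume \<omega>: "\<omega> \<in> Z"
          then have "(SUP t. X t \<omega>) = \<infinity>"
            by (simp only: Z_def mem_Collect_eq)
          with that have "l < (SUP t. X t \<omega>)"
            by (simp only:)
          then show "\<omega> \<in> (\<Union>n. B l n)"
            using \<omega> by (auto simp: less_SUP_iff B_def Z_def)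
        qed
      qed measurable
      also have "\<dots> = (SUP n. emeasure M (B l n))"
        by (rule SUP_emeasure_incseq[symmetric]) (auto simp: incseq_def B_def intro: less_le_trans)
      finally have "l * emeasure M Z \<le> l * (SUP n. emeasure M (B l n))"
        by (intro mult_left_mono) auto
      also have "\<dots> = (SUP n. l * emeasure M (B l n))"
        by (rule SUP_mult_left_ennreal)
      also have "\<dots> \<le> ennreal W * E"
        unfolding E_def by (intro SUP_least order_trans[OF ville mult_right_mono[OF w_le]]) auto
      finally show ?thesis .
    qed
    have "emeasure M Z = 0"
    proof (rule ccontr)
      assume nz: "emeasure M Z \<noteq> 0"
      \<comment> \<open>A non-null \<open>Z\<close> would violate the bound for large levels \<open>l\<close>.\<close>
      have "(SUP n::nat. of_nat n) * emeasure M Z \<le> ennreal W * E"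
        unfolding SUP_mult_right_ennreal by (intro SUP_least bound) (simp add: of_nat_less_top)
      then show False
        using finite_bound nz by (simp add: ennreal_SUP_of_nat_eq_top ennreal_top_mult E_def top_unique)
    qed
    then have "AE \<omega> in M. \<omega> \<notin> Z"
      using Z_M by (intro AE_not_in) (simp add: null_sets_def)
    then show ?thesis
      using AE_space
    proof eventually_elim
      case (elim \<omega>)
      then have "(SUP t. X t \<omega>) \<noteq> \<infinity>"
        unfolding Z_def by blast
      then show ?case
        by (simp only: less_top infinity_ennreal_def)
    qed
  qed
qed

section \<open>Complex matrices and their adjoints\<close>

lemma bounded_linear_complex_matrix_vector_mult:
  fixes A :: "complex ^ 'd ^ 'm"
  shows "bounded_linear ((*v) A)"
  unfolding linear_conv_bounded_linear[symmetric]
proof (rule linearI)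
  show "A *v (c *\<^sub>R x) = c *\<^sub>R (A *v x)" for c x
    by (simp add: matrix_vector_mult_def vec_eq_iff scaleR_sum_right)
qed (rule matrix_vector_right_distrib)

lemma norm_complex_matrix_vector_mult_le:
  fixes A :: "complex ^ 'd ^ 'm"
  shows "norm (A *v x) \<le> onorm ((*v) A) * norm x"
  by (rule onorm[OF bounded_linear_complex_matrix_vector_mult])

lemma sum_rows_norm_le:
  fixes A :: "complex ^ 'd ^ 'm"
  shows "(\<Sum>i\<in>S. (cmod ((A *v x) $ i))\<^sup>2) \<le> (onorm ((*v) A) * norm x)\<^sup>2"
proof -
  have "(\<Sum>i\<in>S. (cmod ((A *v x) $ i))\<^sup>2) \<le> (\<Sum>i\<in>UNIV. (cmod ((A *v x) $ i))\<^sup>2)"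
    by (rule sum_mono2) auto
  also have "\<dots> = (norm (A *v x))\<^sup>2"
    by (simp add: norm_vec_def L2_set_def sum_nonneg)
  also have "\<dots> \<le> (onorm ((*v) A) * norm x)\<^sup>2"
    by (intro power_mono norm_complex_matrix_vector_mult_le) simp
  finally show ?thesis .
qed

text \<open>The product of the conjugate transpose of the submatrix of rows in \<open>S\<close> with the entries of \<open>v\<close> in \<open>S\<close>.\<close>

definition adjoint_rows :: "complex ^ 'd ^ 'm \<Rightarrow> 'm set \<Rightarrow> ('m \<Rightarrow> complex) \<Rightarrow> complex ^ 'd"
  where "adjoint_rows A S v = (\<chi> j. \<Sum>i\<in>S. cnj (A $ i $ j) * v i)"

text \<open>
  On the left stands the real inner product of \<open>complex ^ 'd\<close>, on the right that of \<open>complex\<close>.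
\<close>

lemma adjoint_rows_inner:
  fixes A :: "complex ^ 'd ^ 'm"
  shows "adjoint_rows A S v \<bullet> h = (\<Sum>i\<in>S. v i \<bullet> (A *v h) $ i)"
proof -
  have in1: "(c::complex) \<bullet> d = Re (cnj c * d)" for c d
    by (simp add: inner_complex_def)
  have "adjoint_rows A S v \<bullet> h = (\<Sum>j\<in>UNIV. \<Sum>i\<in>S. Re (A $ i $ j * cnj (v i) * h $ j))"
    unfolding inner_vec_def adjoint_rows_def in1
    by (simp only: vec_lambda_beta cnj_sum complex_cnj_mult complex_cnj_cnj sum_distrib_right Re_sum)
  also have "\<dots> = (\<Sum>i\<in>S. \<Sum>j\<in>UNIV. Re (A $ i $ j * cnj (v i) * h $ j))"
    by (rule sum.swap)
  also have "\<dots> = (\<Sum>i\<in>S. Re (cnj (v i) * (A *v h) $ i))"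
    unfolding matrix_vector_mult_def
    by (simp only: vec_lambda_beta sum_distrib_left Re_sum mult.assoc mult.left_commute)
  finally show ?thesis
    by (simp only: in1)
qed

text \<open>
  The adjoint has the same norm as the matrix: pair \<open>D = A\<^sub>S\<^sup>* v\<close> with itself, move \<open>A\<^sub>S\<close> to the
  other side, apply Cauchy--Schwarz and cancel one factor \<open>\<parallel>D\<parallel>\<close>.
\<close>

lemma norm_adjoint_rows_le:
  fixes A :: "complex ^ 'd ^ 'm"
  shows "norm (adjoint_rows A S v) \<le> onorm ((*v) A) * sqrt (\<Sum>i\<in>S. (cmod (v i))\<^sup>2)"
proof (cases "norm (adjoint_rows A S v) = 0")
  case True
  then show ?thesis
    by (simp add: sum_nonneg onorm_pos_le[OF bounded_linear_complex_matrix_vector_mult])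
next
  case False
  let ?D = "adjoint_rows A S v"
  let ?N = "onorm ((*v) A)"
  have "norm ?D * norm ?D = (\<Sum>i\<in>S. v i \<bullet> (A *v ?D) $ i)"
    by (metis adjoint_rows_inner norm_eq_sqrt_inner real_sqrt_mult_self abs_of_nonneg inner_ge_zero)
  also have "\<dots> \<le> (\<Sum>i\<in>S. \<bar>cmod (v i)\<bar> * \<bar>cmod ((A *v ?D) $ i)\<bar>)"
    by (intro sum_mono) (simp add: norm_cauchy_schwarz)
  also have "\<dots> \<le> L2_set (\<lambda>i. cmod (v i)) S * L2_set (\<lambda>i. cmod ((A *v ?D) $ i)) S"
    by (rule L2_set_mult_ineq)
  also have "\<dots> \<le> sqrt (\<Sum>i\<in>S. (cmod (v i))\<^sup>2) * (?N * norm ?D)"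
    unfolding L2_set_def
    using sum_rows_norm_le[of A ?D S] onorm_pos_le[OF bounded_linear_complex_matrix_vector_mult[of A]]
    by (intro mult_left_mono real_le_lsqrt) (auto simp: sum_nonneg)
  finally have "norm ?D * norm ?D \<le> (?N * sqrt (\<Sum>i\<in>S. (cmod (v i))\<^sup>2)) * norm ?D"
    by (simp add: mult_ac)
  then show ?thesis
    using False by simp
qed

section \<open>The smoothed amplitude loss\<close>

lemma amp_grad_eq_adjoint_rows:
  "amp_grad A y \<epsilon> S z = adjoint_rows A S (\<lambda>i.
     (1 - sqrt (y $ i + \<epsilon>) / sqrt ((cmod ((A *v z) $ i))\<^sup>2 + \<epsilon>)) *\<^sub>R (A *v z) $ i)"
  unfolding amp_grad_def adjoint_rows_def
  by (simp add: scaleR_conv_of_real algebra_simps of_real_diff of_real_divide)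

lemma amp_grad_sum_blocks:
  fixes blk :: "'m::finite \<Rightarrow> 'r::finite"
  shows "(\<Sum>b\<in>UNIV. amp_grad A y \<epsilon> (block_rows blk b) z) = amp_grad A y \<epsilon> UNIV z"
  unfolding amp_grad_def block_rows_def vec_eq_iff
  by (auto intro!: sum.group[of "UNIV :: 'm set" "UNIV :: 'r set" blk, simplified])

text \<open>
  The smoothed modulus is convex, so it lies above its tangent. After multiplication by \<open>sqrt (|v|\<^sup>2 + \<epsilon>)\<close>
  this is Cauchy--Schwarz for the vectors \<open>(v, sqrt \<epsilon>)\<close> and \<open>(v + w, sqrt \<epsilon>)\<close>.
\<close>

lemma smoothed_modulus_tangent_le:
  fixes v w :: "'a::real_inner"
  assumes "0 < \<epsilon>"
  shows "sqrt ((norm v)\<^sup>2 + \<epsilon>) + (v \<bullet> w) / sqrt ((norm v)\<^sup>2 + \<epsilon>) \<le> sqrt ((norm (v + w))\<^sup>2 + \<epsilon>)"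
proof -
  let ?q = "sqrt ((norm v)\<^sup>2 + \<epsilon>)" and ?q' = "sqrt ((norm (v + w))\<^sup>2 + \<epsilon>)"
  have q: "0 < ?q"
    using assms by (simp add: add_nonneg_pos)
  have "?q * ?q + v \<bullet> w = v \<bullet> (v + w) + \<epsilon>"
    using assms by (simp add: power2_norm_eq_inner inner_add_right)
  also have "\<dots> \<le> norm v * norm (v + w) + \<epsilon>"
    by (simp add: norm_cauchy_schwarz)
  also have "\<dots> \<le> sqrt (((norm v)\<^sup>2 + \<epsilon>) * ((norm (v + w))\<^sup>2 + \<epsilon>))"
  proof (rule real_le_rsqrt)
    have "0 \<le> \<epsilon> * (norm v - norm (v + w))\<^sup>2"
      using assms by simp
    then show "(norm v * norm (v + w) + \<epsilon>)\<^sup>2 \<le> ((norm v)\<^sup>2 + \<epsilon>) * ((norm (v + w))\<^sup>2 + \<epsilon>)"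
      by (simp add: algebra_simps power2_eq_square)
  qed
  also have "\<dots> = ?q * ?q'"
    by (rule real_sqrt_mult)
  finally show ?thesis
    using q by (simp add: field_simps)
qed

text \<open>
  Expanding the square, a summand of the loss is \<open>|v|\<^sup>2 + \<epsilon> - 2 c sqrt (|v|\<^sup>2 + \<epsilon>) + c\<^sup>2\<close> with \<open>c \<ge> 0\<close>.
  The tangent bound applies to the middle term, the only one that is not quadratic, and so the
  second-order term is at most \<open>|A h|\<^sup>2\<close>, uniformly in \<open>\<epsilon>\<close>.
\<close>

lemma amp_loss_descent:
  fixes A :: "complex ^ 'd ^ 'm"
  assumes y: "\<And>i. 0 \<le> y $ i" and eps: "0 < \<epsilon>"
  shows "amp_loss A y \<epsilon> S (z + h) \<le>
    amp_loss A y \<epsilon> S z + 2 * (amp_grad A y \<epsilon> S z \<bullet> h) + (onorm ((*v) A) * norm h)\<^sup>2"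
proof -
  define c where "c i = sqrt (y $ i + \<epsilon>)" for i
  have "(sqrt ((cmod ((A *v (z + h)) $ i))\<^sup>2 + \<epsilon>) - c i)\<^sup>2
      \<le> (sqrt ((cmod ((A *v z) $ i))\<^sup>2 + \<epsilon>) - c i)\<^sup>2
        + 2 * (((1 - c i / sqrt ((cmod ((A *v z) $ i))\<^sup>2 + \<epsilon>)) *\<^sub>R (A *v z) $ i) \<bullet> (A *v h) $ i)
        + (cmod ((A *v h) $ i))\<^sup>2" for i
  proof -
    let ?v = "(A *v z) $ i" and ?w = "(A *v h) $ i"
    let ?q = "sqrt ((cmod ?v)\<^sup>2 + \<epsilon>)" and ?q' = "sqrt ((cmod (?v + ?w))\<^sup>2 + \<epsilon>)"
    have "c i * (?q + (?v \<bullet> ?w) / ?q) \<le> c i * ?q'"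
      using smoothed_modulus_tangent_le[OF eps, of ?v ?w] y[of i] eps
      by (intro mult_left_mono) (auto simp: c_def)
    moreover have "?q'\<^sup>2 = ?q\<^sup>2 + 2 * (?v \<bullet> ?w) + (cmod ?w)\<^sup>2"
    proof -
      have "?q'\<^sup>2 = (cmod (?v + ?w))\<^sup>2 + \<epsilon>" "?q\<^sup>2 = (cmod ?v)\<^sup>2 + \<epsilon>"
        using eps by simp_all
      then show ?thesis
        by (simp only: power2_norm_eq_inner inner_add_left inner_add_right inner_commute)
    qed
    moreover have "(q' - d)\<^sup>2 \<le> (q - d)\<^sup>2 + 2 * ((1 - d / q) * b) + e"
      if "d * (q + b / q) \<le> d * q'" "q'\<^sup>2 = q\<^sup>2 + 2 * b + e" for d q q' b e :: real
    proof -
      have "(q' - d)\<^sup>2 = q'\<^sup>2 - 2 * (d * q') + d\<^sup>2" "(q - d)\<^sup>2 = q\<^sup>2 - 2 * (d * q) + d\<^sup>2"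
        "(1 - d / q) * b = b - d * (b / q)" "d * (q + b / q) = d * q + d * (b / q)"
        by (simp_all add: power2_diff left_diff_distrib distrib_left)
      with that show ?thesis
        by linarith
    qed
    ultimately show ?thesis
      unfolding matrix_vector_right_distrib vector_add_component inner_scaleR_left by blast
  qed
  then have "amp_loss A y \<epsilon> S (z + h) \<le> (\<Sum>i\<in>S. (sqrt ((cmod ((A *v z) $ i))\<^sup>2 + \<epsilon>) - c i)\<^sup>2
        + 2 * (((1 - c i / sqrt ((cmod ((A *v z) $ i))\<^sup>2 + \<epsilon>)) *\<^sub>R (A *v z) $ i) \<bullet> (A *v h) $ i)
        + (cmod ((A *v h) $ i))\<^sup>2)"
    unfolding amp_loss_def c_def by (rule sum_mono)
  also have "\<dots> = amp_loss A y \<epsilon> S z + 2 * (amp_grad A y \<epsilon> S z \<bullet> h)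
      + (\<Sum>i\<in>S. (cmod ((A *v h) $ i))\<^sup>2)"
    unfolding amp_loss_def amp_grad_eq_adjoint_rows adjoint_rows_inner c_def
    by (simp add: sum.distrib sum_distrib_left)
  also have "\<dots> \<le> amp_loss A y \<epsilon> S z + 2 * (amp_grad A y \<epsilon> S z \<bullet> h) + (onorm ((*v) A) * norm h)\<^sup>2"
    using sum_rows_norm_le[of A h S] by simp
  finally show ?thesis .
qed

lemma amp_loss_nonneg: "0 \<le> amp_loss A y \<epsilon> S z"
  by (simp add: amp_loss_def sum_nonneg)

lemma amp_loss_mono_rows:
  fixes A :: "complex ^ 'd ^ 'm"
  shows "amp_loss A y \<epsilon> S z \<le> amp_loss A y \<epsilon> UNIV z"
  unfolding amp_loss_def by (rule sum_mono2) auto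

text \<open>
  With \<open>q = sqrt (|v|\<^sup>2 + \<epsilon>)\<close> and \<open>c = sqrt (y\<^sub>i + \<epsilon>)\<close>, row \<open>i\<close> of the residual that \<open>A\<^sub>S\<^sup>*\<close> acts on
  has modulus \<open>|q - c| |v| / q \<le> |q - c|\<close>, the square root of the row's summand of the loss.
\<close>

lemma norm_amp_grad_le_sqrt_loss:
  fixes A :: "complex ^ 'd ^ 'm"
  assumes eps: "0 < \<epsilon>"
  shows "norm (amp_grad A y \<epsilon> S z) \<le> onorm ((*v) A) * sqrt (amp_loss A y \<epsilon> UNIV z)"
proof -
  have res: "(cmod ((1 - sqrt (y $ i + \<epsilon>) / sqrt ((cmod v)\<^sup>2 + \<epsilon>)) *\<^sub>R v))\<^sup>2
      \<le> (sqrt ((cmod v)\<^sup>2 + \<epsilon>) - sqrt (y $ i + \<epsilon>))\<^sup>2" for i and v :: complex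
  proof -
    let ?q = "sqrt ((cmod v)\<^sup>2 + \<epsilon>)" and ?c = "sqrt (y $ i + \<epsilon>)"
    have q: "0 < ?q" "cmod v \<le> ?q"
      using eps by (auto simp: add_nonneg_pos intro: real_le_rsqrt)
    have "1 - ?c / ?q = (?q - ?c) / ?q"
      using q(1) by (simp only: diff_divide_distrib) simp
    then have "cmod ((1 - ?c / ?q) *\<^sub>R v) = \<bar>?q - ?c\<bar> * (cmod v / ?q)"
      using q(1) by (simp only: norm_scaleR abs_divide abs_of_pos) simp
    also have "\<dots> \<le> \<bar>?q - ?c\<bar> * 1"
      using q by (intro mult_left_mono) auto
    finally show ?thesis
      by (simp add: abs_le_square_iff[symmetric])
  qed
  have N: "0 \<le> onorm ((*v) A)"
    by (rule onorm_pos_le[OF bounded_linear_complex_matrix_vector_mult])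
  have "norm (amp_grad A y \<epsilon> S z) \<le> onorm ((*v) A) * sqrt (amp_loss A y \<epsilon> S z)"
    unfolding amp_grad_eq_adjoint_rows
    by (rule order_trans[OF norm_adjoint_rows_le])
       (auto simp: amp_loss_def simp del: norm_scaleR intro!: mult_left_mono N sum_mono res)
  also have "\<dots> \<le> onorm ((*v) A) * sqrt (amp_loss A y \<epsilon> UNIV z)"
    by (intro mult_left_mono real_sqrt_le_mono amp_loss_mono_rows N)
  finally show ?thesis .
qed

text \<open>
  The smoothed modulus of \<open>v\<close> is the norm of the pair \<open>(v, sqrt \<epsilon>)\<close>, and a norm is 1-Lipschitz.
\<close>

lemma sqrt_norm_square_add_lipschitz:
  fixes v w :: "'a::real_normed_vector"
  assumes "0 < \<epsilon>"
  shows "\<bar>sqrt ((norm v)\<^sup>2 + \<epsilon>) - sqrt ((norm w)\<^sup>2 + \<epsilon>)\<bar> \<le> norm (v - w)"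
proof -
  have "\<bar>sqrt ((norm v)\<^sup>2 + (sqrt \<epsilon>)\<^sup>2) - sqrt ((norm w)\<^sup>2 + (sqrt \<epsilon>)\<^sup>2)\<bar> \<le> \<bar>norm v - norm w\<bar>"
    using norm_triangle_ineq3[of "(norm v, sqrt \<epsilon>)" "(norm w, sqrt \<epsilon>)"] by (simp add: norm_Pair)
  then show ?thesis
    using assms norm_triangle_ineq3[of v w] by simp
qed

text \<open>
  Of the factor 2, one part is the change of the numerator and the other that of the denominator.
\<close>

lemma normalized_lipschitz:
  fixes v w :: "'a::real_normed_vector"
  assumes "0 < \<epsilon>"
  shows "norm (v /\<^sub>R sqrt ((norm v)\<^sup>2 + \<epsilon>) - w /\<^sub>R sqrt ((norm w)\<^sup>2 + \<epsilon>)) \<le> 2 / sqrt \<epsilon> * norm (v - w)"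
proof -
  let ?q = "sqrt ((norm v)\<^sup>2 + \<epsilon>)" and ?q' = "sqrt ((norm w)\<^sup>2 + \<epsilon>)"
  have q: "0 < ?q" "0 < ?q'" "sqrt \<epsilon> \<le> ?q" "norm w \<le> ?q'"
    using assms by (auto simp: add_nonneg_pos intro: real_le_rsqrt)
  have "v /\<^sub>R ?q - w /\<^sub>R ?q' = inverse ?q *\<^sub>R ((v - w) + ((?q' - ?q) / ?q') *\<^sub>R w)"
  proof -
    have "v /\<^sub>R a - w /\<^sub>R b = inverse a *\<^sub>R ((v - w) + ((b - a) / b) *\<^sub>R w)"
      if "0 < a" "0 < b" for a b :: real
      using that by (simp add: scaleR_right_diff_distrib scaleR_right_distrib scaleR_left_diff_distrib
          diff_divide_distrib inverse_eq_divide)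
    with q show ?thesis by blast
  qed
  also have "norm \<dots> = (norm ((v - w) + ((?q' - ?q) / ?q') *\<^sub>R w)) / ?q"
    using q by (simp add: divide_inverse)
  also have "\<dots> \<le> (norm (v - w) + \<bar>?q' - ?q\<bar> * (norm w / ?q')) / ?q"
    using q by (intro divide_right_mono norm_triangle_le) auto
  also have "\<dots> \<le> (norm (v - w) + norm (v - w) * 1) / sqrt \<epsilon>"
    using q assms sqrt_norm_square_add_lipschitz[OF assms, of w v]
    by (intro frac_le add_mono mult_mono) (auto simp: norm_minus_commute)
  finally show ?thesis
    by (simp add: field_simps)
qed

text \<open>
  This bounds the change of the gradient norm along the iteration. The constant found contains
  the factor \<open>1 / sqrt \<epsilon>\<close>; the step size condition stems from the descent bound, whose constant is \<open>\<parallel>A\<parallel>\<^sup>2\<close>.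
\<close>

lemma amp_grad_lipschitz:
  fixes A :: "complex ^ 'd ^ 'm"
  assumes eps: "0 < \<epsilon>"
  obtains C where "0 \<le> C" "\<And>z z'. norm (amp_grad A y \<epsilon> S z - amp_grad A y \<epsilon> S z') \<le> C * norm (z - z')"
proof -
  define N where "N = onorm ((*v) A)"
  define C where "C = 1 + (\<Sum>i\<in>UNIV. \<bar>sqrt (y $ i + \<epsilon>)\<bar>) * (2 / sqrt \<epsilon>)"
  have C: "0 \<le> C"
    using eps by (auto simp: C_def intro!: add_nonneg_nonneg mult_nonneg_nonneg sum_nonneg)
  have N: "0 \<le> N"
    unfolding N_def by (rule onorm_pos_le[OF bounded_linear_complex_matrix_vector_mult])
  define u where "u i v = (1 - sqrt (y $ i + \<epsilon>) / sqrt ((cmod v)\<^sup>2 + \<epsilon>)) *\<^sub>R v" for i and v :: complex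
  have u: "cmod (u i v - u i w) \<le> C * cmod (v - w)" for i v w
  proof -
    let ?e = "\<lambda>v. v /\<^sub>R sqrt ((cmod v)\<^sup>2 + \<epsilon>)"
    have "u i v - u i w = (v - w) - sqrt (y $ i + \<epsilon>) *\<^sub>R (?e v - ?e w)"
      unfolding u_def by (simp add: algebra_simps divide_inverse)
    then have "cmod (u i v - u i w) \<le> cmod (v - w) + \<bar>sqrt (y $ i + \<epsilon>)\<bar> * cmod (?e v - ?e w)"
      using norm_triangle_ineq4[of "v - w" "sqrt (y $ i + \<epsilon>) *\<^sub>R (?e v - ?e w)"] by simp
    also have "\<dots> \<le> cmod (v - w) + (\<Sum>i\<in>UNIV. \<bar>sqrt (y $ i + \<epsilon>)\<bar>) * (2 / sqrt \<epsilon> * cmod (v - w))"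
      by (intro add_left_mono mult_mono normalized_lipschitz eps member_le_sum sum_nonneg) auto
    also have "\<dots> = C * cmod (v - w)"
      by (simp add: C_def algebra_simps)
    finally show ?thesis .
  qed
  have "norm (amp_grad A y \<epsilon> S z - amp_grad A y \<epsilon> S z') \<le> (N * (C * N)) * norm (z - z')" for z z'
  proof -
    have "amp_grad A y \<epsilon> S z - amp_grad A y \<epsilon> S z'
        = adjoint_rows A S (\<lambda>i. u i ((A *v z) $ i) - u i ((A *v z') $ i))"
      unfolding amp_grad_eq_adjoint_rows u_def adjoint_rows_def
      by (simp add: vec_eq_iff sum_subtractf right_diff_distrib del: scaleR_conv_of_real)
    also have "norm \<dots> \<le> N * sqrt (\<Sum>i\<in>S. (cmod (u i ((A *v z) $ i) - u i ((A *v z') $ i)))\<^sup>2)"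
      unfolding N_def by (rule norm_adjoint_rows_le)
    also have "\<dots> \<le> N * sqrt (\<Sum>i\<in>S. (C * cmod ((A *v (z - z')) $ i))\<^sup>2)"
      by (intro mult_left_mono real_sqrt_le_mono sum_mono power_mono N)
         (use u in \<open>auto simp: matrix_vector_mult_diff_distrib\<close>)
    also have "\<dots> = N * (C * sqrt (\<Sum>i\<in>S. (cmod ((A *v (z - z')) $ i))\<^sup>2))"
      using C by (simp add: power_mult_distrib sum_distrib_left[symmetric] real_sqrt_mult)
    also have "\<dots> \<le> N * (C * (N * norm (z - z')))"
      using C N sum_rows_norm_le[of A "z - z'" S]
      by (intro mult_left_mono real_le_lsqrt) (auto simp: N_def sum_nonneg)
    finally show ?thesis
      by (simp add: mult_ac)
  qed
  then show thesis
    using that[of "N * (C * N)"] C N by simp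
qed

section \<open>Means of independent samples\<close>

context prob_space
begin

lemma
  fixes X :: "'a \<Rightarrow> 'r::finite" and f :: "'r \<Rightarrow> real"
  assumes X[measurable]: "X \<in> measurable M (count_space UNIV)"
    and distr: "distr M (count_space UNIV) X = measure_pmf p"
  shows integrable_finite_range: "integrable M (\<lambda>\<omega>. f (X \<omega>))"
    and expectation_finite_range: "expectation (\<lambda>\<omega>. f (X \<omega>)) = (\<Sum>b\<in>UNIV. pmf p b * f b)"
proof -
  have "integrable (distr M (count_space UNIV) X) f"
    unfolding distr by (rule integrable_measure_pmf_finite) simp
  then show "integrable M (\<lambda>\<omega>. f (X \<omega>))"
    by (rule integrable_distr[OF X])
  have "expectation (\<lambda>\<omega>. f (X \<omega>)) = (\<integral>b. f b \<partial>distr M (count_space UNIV) X)"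
    by (rule integral_distr[symmetric]) auto
  also have "\<dots> = (\<Sum>b\<in>UNIV. f b * pmf p b)"
    unfolding distr by (rule integral_measure_pmf_real) auto
  finally show "expectation (\<lambda>\<omega>. f (X \<omega>)) = (\<Sum>b\<in>UNIV. pmf p b * f b)"
    by (simp add: mult.commute)
qed

text \<open>
  The samples \<open>h (X\<^sub>k)\<close>, \<open>k \<in> I\<close>, are independent with common mean \<open>\<Sum>\<^sub>b p\<^sub>b h b\<close>.
\<close>

context
  fixes X :: "'k \<Rightarrow> 'a \<Rightarrow> 'r::finite" and h :: "'r \<Rightarrow> 'v::euclidean_space" and I :: "'k set" and p :: "'r pmf"
  assumes indep: "indep_vars (\<lambda>_. count_space UNIV) X I"
    and finite_I: "finite I" and nonempty_I: "I \<noteq> {}"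
    and distr: "\<And>k. k \<in> I \<Longrightarrow> distr M (count_space UNIV) (X k) = measure_pmf p"
begin

lemma
  assumes k: "k \<in> I" and l: "l \<in> I"
  shows sample_inner_integrable: "integrable M (\<lambda>\<omega>. h (X k \<omega>) \<bullet> h (X l \<omega>))"
    and sample_inner_expectation: "expectation (\<lambda>\<omega>. h (X k \<omega>) \<bullet> h (X l \<omega>)) =
      (if k = l then \<Sum>b\<in>UNIV. pmf p b * (norm (h b))\<^sup>2 else (norm (\<Sum>b\<in>UNIV. pmf p b *\<^sub>R h b))\<^sup>2)"
proof -
  have rv: "X j \<in> measurable M (count_space UNIV)" if "j \<in> I" for j
    using indep that by (auto simp: indep_vars_def)
  have "integrable M (\<lambda>\<omega>. h (X k \<omega>) \<bullet> h (X l \<omega>)) \<and>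
    expectation (\<lambda>\<omega>. h (X k \<omega>) \<bullet> h (X l \<omega>)) =
      (if k = l then \<Sum>b\<in>UNIV. pmf p b * (norm (h b))\<^sup>2 else (norm (\<Sum>b\<in>UNIV. pmf p b *\<^sub>R h b))\<^sup>2)"
  proof (cases "k = l")
    case True
    then show ?thesis
      using integrable_finite_range[OF rv[OF k] distr[OF k], of "\<lambda>b. h b \<bullet> h b"]
        expectation_finite_range[OF rv[OF k] distr[OF k], of "\<lambda>b. h b \<bullet> h b"]
      by (simp add: power2_norm_eq_inner)
  next
    case False
    let ?m = "\<Sum>b\<in>UNIV. pmf p b *\<^sub>R h b"
    \<comment> \<open>Independence factorises expectations of real products, so the inner product is taken coordinatewise.\<close>
    have ind: "indep_var borel (\<lambda>\<omega>. h (X k \<omega>) \<bullet> e) borel (\<lambda>\<omega>. h (X l \<omega>) \<bullet> e)" for e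
    proof -
      have meas: "(\<lambda>u. h (u j) \<bullet> e) \<in> borel_measurable (PiM {j} (\<lambda>_. count_space UNIV))" for j :: 'k
        using measurable_compose[OF measurable_component_singleton[of j "{j}" "\<lambda>_. count_space UNIV"],
            of "\<lambda>b. h b \<bullet> e" borel] by simp
      have "indep_var (PiM {k} (\<lambda>_. count_space UNIV)) (\<lambda>\<omega>. restrict (\<lambda>i. X i \<omega>) {k})
          (PiM {l} (\<lambda>_. count_space UNIV)) (\<lambda>\<omega>. restrict (\<lambda>i. X i \<omega>) {l})"
        using False k l by (intro indep_var_restrict[OF indep]) auto
      from indep_var_compose[OF this meas meas]
      have "indep_var borel ((\<lambda>u. h (u k) \<bullet> e) \<circ> (\<lambda>\<omega>. restrict (\<lambda>i. X i \<omega>) {k}))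
          borel ((\<lambda>u. h (u l) \<bullet> e) \<circ> (\<lambda>\<omega>. restrict (\<lambda>i. X i \<omega>) {l}))" .
      then show ?thesis
        by (simp add: comp_def)
    qed
    note ik = integrable_finite_range[OF rv[OF k] distr[OF k]]
      and il = integrable_finite_range[OF rv[OF l] distr[OF l]]
      and ek = expectation_finite_range[OF rv[OF k] distr[OF k]]
      and el = expectation_finite_range[OF rv[OF l] distr[OF l]]
    have m: "(\<Sum>b\<in>UNIV. pmf p b * (h b \<bullet> e)) = ?m \<bullet> e" for e
      by (simp add: inner_sum_left)
    have int: "integrable M (\<lambda>\<omega>. (h (X k \<omega>) \<bullet> e) * (h (X l \<omega>) \<bullet> e))"
      and ex: "expectation (\<lambda>\<omega>. (h (X k \<omega>) \<bullet> e) * (h (X l \<omega>) \<bullet> e)) = (?m \<bullet> e) * (?m \<bullet> e)" for e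
      using indep_var_integrable[OF ind ik[of "\<lambda>b. h b \<bullet> e"] il[of "\<lambda>b. h b \<bullet> e"]]
        indep_var_lebesgue_integral[OF ind ik[of "\<lambda>b. h b \<bullet> e"] il[of "\<lambda>b. h b \<bullet> e"]]
      by (simp_all add: ek[of "\<lambda>b. h b \<bullet> e"] el[of "\<lambda>b. h b \<bullet> e"] m)
    have eq: "(\<lambda>\<omega>. h (X k \<omega>) \<bullet> h (X l \<omega>)) = (\<lambda>\<omega>. \<Sum>e\<in>Basis. (h (X k \<omega>) \<bullet> e) * (h (X l \<omega>) \<bullet> e))"
      by (rule ext) (rule euclidean_inner)
    have "(norm ?m)\<^sup>2 = (\<Sum>e\<in>Basis. (?m \<bullet> e) * (?m \<bullet> e))"
      unfolding power2_norm_eq_inner by (rule euclidean_inner)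
    then show ?thesis
      unfolding eq using False int by (simp add: Bochner_Integration.integral_sum ex)
  qed
  then show "integrable M (\<lambda>\<omega>. h (X k \<omega>) \<bullet> h (X l \<omega>))"
    "expectation (\<lambda>\<omega>. h (X k \<omega>) \<bullet> h (X l \<omega>)) =
      (if k = l then \<Sum>b\<in>UNIV. pmf p b * (norm (h b))\<^sup>2 else (norm (\<Sum>b\<in>UNIV. pmf p b *\<^sub>R h b))\<^sup>2)"
    by auto
qed

lemma
  shows sample_mean_inner_integrable: "integrable M (\<lambda>\<omega>. v \<bullet> ((1 / card I) *\<^sub>R (\<Sum>k\<in>I. h (X k \<omega>))))"
    and sample_mean_inner_expectation:
      "expectation (\<lambda>\<omega>. v \<bullet> ((1 / card I) *\<^sub>R (\<Sum>k\<in>I. h (X k \<omega>)))) = v \<bullet> (\<Sum>b\<in>UNIV. pmf p b *\<^sub>R h b)"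
proof -
  have rv: "X j \<in> measurable M (count_space UNIV)" if "j \<in> I" for j
    using indep that by (auto simp: indep_vars_def)
  have int: "integrable M (\<lambda>\<omega>. v \<bullet> h (X k \<omega>))"
    and ex: "expectation (\<lambda>\<omega>. v \<bullet> h (X k \<omega>)) = v \<bullet> (\<Sum>b\<in>UNIV. pmf p b *\<^sub>R h b)" if "k \<in> I" for k
    using integrable_finite_range[OF rv[OF that] distr[OF that], of "\<lambda>b. v \<bullet> h b"]
      expectation_finite_range[OF rv[OF that] distr[OF that], of "\<lambda>b. v \<bullet> h b"]
    by (simp_all add: inner_sum_right)
  show "integrable M (\<lambda>\<omega>. v \<bullet> ((1 / card I) *\<^sub>R (\<Sum>k\<in>I. h (X k \<omega>))))"
    unfolding inner_scaleR_right inner_sum_right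
    by (intro integrable_mult_right Bochner_Integration.integrable_sum int)
  have "expectation (\<lambda>\<omega>. v \<bullet> ((1 / card I) *\<^sub>R (\<Sum>k\<in>I. h (X k \<omega>))))
      = (1 / card I) * (\<Sum>k\<in>I. v \<bullet> (\<Sum>b\<in>UNIV. pmf p b *\<^sub>R h b))"
    unfolding inner_scaleR_right inner_sum_right[of v _ I]
    by (subst integral_mult_right_zero, subst Bochner_Integration.integral_sum) (auto simp: int ex)
  then show "expectation (\<lambda>\<omega>. v \<bullet> ((1 / card I) *\<^sub>R (\<Sum>k\<in>I. h (X k \<omega>)))) = v \<bullet> (\<Sum>b\<in>UNIV. pmf p b *\<^sub>R h b)"
    using finite_I nonempty_I by simp
qed

text \<open>
  Of the \<open>(card I)\<^sup>2\<close> inner products in the expanded square, the \<open>card I\<close> diagonal ones contribute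
  the second moment of a single sample and the others the squared norm of the mean.
\<close>

lemma
  shows sample_mean_norm_integrable: "integrable M (\<lambda>\<omega>. (norm ((1 / card I) *\<^sub>R (\<Sum>k\<in>I. h (X k \<omega>))))\<^sup>2)"
    and sample_mean_norm_expectation:
      "expectation (\<lambda>\<omega>. (norm ((1 / card I) *\<^sub>R (\<Sum>k\<in>I. h (X k \<omega>))))\<^sup>2) =
        (1 / card I) * (\<Sum>b\<in>UNIV. pmf p b * (norm (h b))\<^sup>2)
        + (1 - 1 / card I) * (norm (\<Sum>b\<in>UNIV. pmf p b *\<^sub>R h b))\<^sup>2"
proof -
  let ?V = "\<Sum>b\<in>UNIV. pmf p b * (norm (h b))\<^sup>2" and ?m = "(norm (\<Sum>b\<in>UNIV. pmf p b *\<^sub>R h b))\<^sup>2"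
  have card: "real (card I) > 0"
    using finite_I nonempty_I by (simp add: card_gt_0_iff)
  have eq: "(norm ((1 / card I) *\<^sub>R (\<Sum>k\<in>I. h (X k \<omega>))))\<^sup>2 =
      (1 / card I)\<^sup>2 * (\<Sum>k\<in>I. \<Sum>l\<in>I. h (X k \<omega>) \<bullet> h (X l \<omega>))" for \<omega>
  proof -
    have "(norm (c *\<^sub>R x))\<^sup>2 = c\<^sup>2 * (x \<bullet> x)" for c and x :: 'v
      by (simp add: power_mult_distrib power2_norm_eq_inner)
    then show ?thesis
      by (simp only: inner_sum_left) (simp only: inner_sum_right)
  qed
  show "integrable M (\<lambda>\<omega>. (norm ((1 / card I) *\<^sub>R (\<Sum>k\<in>I. h (X k \<omega>))))\<^sup>2)"
    unfolding eq by (intro integrable_mult_right Bochner_Integration.integrable_sum sample_inner_integrable)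
  have "expectation (\<lambda>\<omega>. (norm ((1 / card I) *\<^sub>R (\<Sum>k\<in>I. h (X k \<omega>))))\<^sup>2)
      = (1 / card I)\<^sup>2 * (\<Sum>k\<in>I. \<Sum>l\<in>I. if k = l then ?V else ?m)"
    unfolding eq
    by (simp add: Bochner_Integration.integral_sum Bochner_Integration.integrable_sum
        sample_inner_integrable sample_inner_expectation)
  also have "(\<Sum>k\<in>I. \<Sum>l\<in>I. if k = l then ?V else ?m) = (\<Sum>k\<in>I. ?V + (real (card I) - 1) * ?m)"
  proof (rule sum.cong[OF refl])
    fix k assume k: "k \<in> I"
    have "(\<Sum>l\<in>I. if k = l then ?V else ?m) = (\<Sum>l\<in>I. (if k = l then ?V - ?m else 0) + ?m)"
      by (intro sum.cong) auto
    then show "(\<Sum>l\<in>I. if k = l then ?V else ?m) = ?V + (real (card I) - 1) * ?m"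
      using k finite_I by (simp add: sum.distrib algebra_simps)
  qed
  also have "(1 / card I)\<^sup>2 * (\<Sum>k\<in>I. ?V + (real (card I) - 1) * ?m)
      = (1 / card I) * ?V + (1 - 1 / card I) * ?m"
    using card by (simp add: power2_eq_square field_simps)
  finally show "expectation (\<lambda>\<omega>. (norm ((1 / card I) *\<^sub>R (\<Sum>k\<in>I. h (X k \<omega>))))\<^sup>2) =
      (1 / card I) * ?V + (1 - 1 / card I) * ?m" .
qed

end

text \<open>
  Averaging over the fresh variable \<open>V\<close> with \<open>U\<close> held fixed: this plays the part of conditioning
  on \<open>U\<close>.
\<close>

lemma nn_integral_indep_var:
  assumes indep: "indep_var S U T V" and f[measurable]: "f \<in> borel_measurable (S \<Otimes>\<^sub>M T)"
  shows "(\<integral>\<^sup>+\<omega>. f (U \<omega>, V \<omega>) \<partial>M) = (\<integral>\<^sup>+\<omega>. (\<integral>\<^sup>+\<omega>'. f (U \<omega>, V \<omega>') \<partial>M) \<partial>M)"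
proof -
  have U[measurable]: "U \<in> measurable M S" and V[measurable]: "V \<in> measurable M T"
    using indep by (auto dest: indep_var_rv1 indep_var_rv2)
  interpret V: prob_space "distr M T V"
    by (rule prob_space_distr) measurable
  have "(\<integral>\<^sup>+\<omega>. f (U \<omega>, V \<omega>) \<partial>M) = (\<integral>\<^sup>+x. f x \<partial>distr M (S \<Otimes>\<^sub>M T) (\<lambda>\<omega>. (U \<omega>, V \<omega>)))"
    by (rule nn_integral_distr[symmetric]) measurable
  also have "\<dots> = (\<integral>\<^sup>+x. f x \<partial>(distr M S U \<Otimes>\<^sub>M distr M T V))"
    using indep by (simp add: indep_var_distribution_eq)
  also have "\<dots> = (\<integral>\<^sup>+u. (\<integral>\<^sup>+v. f (u, v) \<partial>distr M T V) \<partial>distr M S U)"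
    by (rule V.nn_integral_fst[symmetric]) simp
  also have "\<dots> = (\<integral>\<^sup>+\<omega>. (\<integral>\<^sup>+v. f (U \<omega>, v) \<partial>distr M T V) \<partial>M)"
    by (rule nn_integral_distr) measurable
  also have "\<dots> = (\<integral>\<^sup>+\<omega>. (\<integral>\<^sup>+\<omega>'. f (U \<omega>, V \<omega>') \<partial>M) \<partial>M)"
    by (intro nn_integral_cong nn_integral_distr) (auto intro: measurable_space)
  finally show ?thesis .
qed

end

section \<open>One step of Stochastic Amplitude Flow\<close>

text \<open>
  This holds for every choice of indices, hence along each path of the iteration. The sum
  of all \<open>1 / p\<^sub>b\<close> bounds each single weight, whichever blocks are drawn.
\<close>

lemma norm_stoch_grad_le:
  fixes A :: "complex ^ 'd ^ 'm" and blk :: "'m \<Rightarrow> 'r::finite"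
  assumes eps: "0 < \<epsilon>" and K: "1 \<le> K" and p: "\<And>b. 0 < pmf p b"
  shows "norm (stoch_grad A y \<epsilon> blk p K r z)
    \<le> (\<Sum>b\<in>UNIV. 1 / pmf p b) * (onorm ((*v) A) * sqrt (amp_loss A y \<epsilon> UNIV z))"
    (is "_ \<le> ?P * ?B")
proof -
  have B: "0 \<le> ?B"
    by (rule order_trans[OF norm_ge_zero norm_amp_grad_le_sqrt_loss[OF eps]])
  have "norm (\<Sum>k=1..K. (1 / pmf p (r k)) *\<^sub>R amp_grad A y \<epsilon> (block_rows blk (r k)) z) \<le> (\<Sum>k=1..K. ?P * ?B)"
  proof (rule sum_norm_le)
    fix k
    have "1 / pmf p (r k) \<le> ?P"
      using p by (intro member_le_sum) (auto intro: less_imp_le)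
    then have "1 / pmf p (r k) * norm (amp_grad A y \<epsilon> (block_rows blk (r k)) z) \<le> ?P * ?B"
      using p by (intro mult_mono norm_amp_grad_le_sqrt_loss eps sum_nonneg) (auto intro: less_imp_le)
    then show "norm ((1 / pmf p (r k)) *\<^sub>R amp_grad A y \<epsilon> (block_rows blk (r k)) z) \<le> ?P * ?B"
      by simp
  qed
  then show ?thesis
    using K by (simp add: stoch_grad_def divide_le_eq mult.commute)
qed

text \<open>
  The current point \<open>z\<close> is fixed and only the index vector \<open>\<rho>\<close> is random. The descent bound at
  \<open>- \<mu> g\<close> has expectation
  \<open>L - 2 \<mu> \<parallel>G\<parallel>\<^sup>2 + \<mu>\<^sup>2 \<parallel>A\<parallel>\<^sup>2 ((1/K) \<Sum>\<^sub>b \<parallel>G\<^sub>b\<parallel>\<^sup>2 / p\<^sub>b + (1 - 1/K) \<parallel>G\<parallel>\<^sup>2)\<close>.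
  The step size condition bounds the last term by \<open>\<mu> \<parallel>G\<parallel>\<^sup>2\<close>, and \<open>\<parallel>G\<^sub>b\<parallel>\<^sup>2 \<le> \<parallel>A\<parallel>\<^sup>2 L\<close> turns the sum
  over blocks into a multiple of \<open>\<mu>\<^sup>2 L\<close>. The factor \<open>1/K\<close> is bounded by 1.
\<close>

lemma (in prob_space) expected_loss_decrease:
  fixes A :: "complex ^ 'd ^ 'm" and blk :: "'m \<Rightarrow> 'r::finite" and \<rho> :: "nat \<Rightarrow> 'a \<Rightarrow> 'r"
  assumes y: "\<And>i. 0 \<le> y $ i" and eps: "0 < \<epsilon>" and K: "1 \<le> K" and p: "\<And>b. 0 < pmf p b"
    and indep: "indep_vars (\<lambda>_. count_space UNIV) \<rho> {1..K}"
    and distr: "\<And>k. k \<in> {1..K} \<Longrightarrow> distr M (count_space UNIV) (\<rho> k) = measure_pmf p"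
    and mu: "0 \<le> \<mu>" and mu_bound: "(1 - 1 / real K) * (onorm ((*v) A))\<^sup>2 * \<mu> \<le> 1"
  shows "(\<integral>\<^sup>+\<omega>. ennreal (amp_loss A y \<epsilon> UNIV (z - \<mu> *\<^sub>R stoch_grad A y \<epsilon> blk p K (\<lambda>k. \<rho> k \<omega>) z)) \<partial>M)
      + ennreal (\<mu> * (norm (amp_grad A y \<epsilon> UNIV z))\<^sup>2)
    \<le> ennreal (1 + (onorm ((*v) A)) ^ 4 * (\<Sum>b\<in>UNIV. 1 / pmf p b) * \<mu>\<^sup>2) * ennreal (amp_loss A y \<epsilon> UNIV z)"
proof -
  define N where "N = onorm ((*v) A)"
  define L where "L = amp_loss A y \<epsilon> UNIV"
  define G where "G = amp_grad A y \<epsilon> UNIV z"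
  define h where "h b = (1 / pmf p b) *\<^sub>R amp_grad A y \<epsilon> (block_rows blk b) z" for b
  define g where "g \<omega> = stoch_grad A y \<epsilon> blk p K (\<lambda>k. \<rho> k \<omega>) z" for \<omega>
  define P where "P = (\<Sum>b\<in>UNIV. 1 / pmf p b)"
  have N: "0 \<le> N"
    unfolding N_def by (rule onorm_pos_le[OF bounded_linear_complex_matrix_vector_mult])
  have P: "0 \<le> P"
    unfolding P_def by (intro sum_nonneg) (simp add: less_imp_le)
  have L: "0 \<le> L w" for w
    unfolding L_def by (rule amp_loss_nonneg)
  have g: "g = (\<lambda>\<omega>. (1 / card {1..K}) *\<^sub>R (\<Sum>k\<in>{1..K}. h (\<rho> k \<omega>)))"
    by (simp add: g_def stoch_grad_def h_def fun_eq_iff)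
  have mean: "(\<Sum>b\<in>UNIV. pmf p b *\<^sub>R h b) = G"
    using p amp_grad_sum_blocks[where blk = blk and A = A and y = y and \<epsilon> = \<epsilon> and z = z]
    by (simp add: h_def G_def less_imp_neq[symmetric])
  have ne: "{1..K} \<noteq> {}"
    using K by simp
  note sample = indep finite_atLeastAtMost ne distr
  have second: "(\<Sum>b\<in>UNIV. pmf p b * (norm (h b))\<^sup>2) \<le> P * (N\<^sup>2 * L z)"
    unfolding P_def sum_distrib_right
  proof (rule sum_mono)
    fix b
    have "(norm (amp_grad A y \<epsilon> (block_rows blk b) z))\<^sup>2 \<le> (N * sqrt (L z))\<^sup>2"
      unfolding N_def L_def by (intro power_mono norm_amp_grad_le_sqrt_loss eps) simp
    also have "\<dots> = N\<^sup>2 * L z"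
      using L by (simp add: power_mult_distrib)
    finally have "1 / pmf p b * (norm (amp_grad A y \<epsilon> (block_rows blk b) z))\<^sup>2 \<le> 1 / pmf p b * (N\<^sup>2 * L z)"
      using p by (intro mult_left_mono) (auto intro: less_imp_le)
    then show "pmf p b * (norm (h b))\<^sup>2 \<le> 1 / pmf p b * (N\<^sup>2 * L z)"
      using p[of b] by (simp add: h_def power_mult_distrib power_divide power2_eq_square)
  qed
  define Q where "Q \<omega> = L z - 2 * \<mu> * (G \<bullet> g \<omega>) + (N * \<mu>)\<^sup>2 * (norm (g \<omega>))\<^sup>2" for \<omega>
  have LQ: "L (z - \<mu> *\<^sub>R g \<omega>) \<le> Q \<omega>" for \<omega>
    using amp_loss_descent[OF y eps, where S = UNIV and A = A and z = z and h = "- (\<mu> *\<^sub>R g \<omega>)"] mu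
    by (simp add: L_def G_def N_def Q_def power_mult_distrib mult_ac)
  have i1: "integrable M (\<lambda>\<omega>. G \<bullet> g \<omega>)" and i2: "integrable M (\<lambda>\<omega>. (norm (g \<omega>))\<^sup>2)"
    and e1: "expectation (\<lambda>\<omega>. G \<bullet> g \<omega>) = (norm G)\<^sup>2"
    and e2: "expectation (\<lambda>\<omega>. (norm (g \<omega>))\<^sup>2)
      = (1 / K) * (\<Sum>b\<in>UNIV. pmf p b * (norm (h b))\<^sup>2) + (1 - 1 / K) * (norm G)\<^sup>2"
    using sample_mean_inner_integrable[OF sample, of G h] sample_mean_norm_integrable[OF sample, of h]
      sample_mean_inner_expectation[OF sample, of G h] sample_mean_norm_expectation[OF sample, of h]
    unfolding g mean by (simp_all add: power2_norm_eq_inner)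
  have Q_int: "integrable M Q"
    unfolding Q_def using i1 i2 by simp
  have "expectation Q = L z - 2 * \<mu> * (norm G)\<^sup>2 + (N * \<mu>)\<^sup>2 *
      ((1 / K) * (\<Sum>b\<in>UNIV. pmf p b * (norm (h b))\<^sup>2) + (1 - 1 / K) * (norm G)\<^sup>2)"
    unfolding Q_def using i1 i2 by (simp add: e1 e2 prob_space)
  also have "\<dots> \<le> L z - 2 * \<mu> * (norm G)\<^sup>2 + (N * \<mu>)\<^sup>2 * (P * (N\<^sup>2 * L z)) + \<mu> * (norm G)\<^sup>2"
  proof -
    have "(1 / K) * (\<Sum>b\<in>UNIV. pmf p b * (norm (h b))\<^sup>2) \<le> 1 * (P * (N\<^sup>2 * L z))"
      using K by (intro mult_mono second sum_nonneg) auto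
    then have "(N * \<mu>)\<^sup>2 * ((1 / K) * (\<Sum>b\<in>UNIV. pmf p b * (norm (h b))\<^sup>2)) \<le> (N * \<mu>)\<^sup>2 * (P * (N\<^sup>2 * L z))"
      by (intro mult_left_mono) auto
    moreover have "(N * \<mu>)\<^sup>2 * ((1 - 1 / K) * (norm G)\<^sup>2) \<le> \<mu> * (norm G)\<^sup>2"
    proof -
      have "((1 - 1 / real K) * N\<^sup>2 * \<mu>) * (\<mu> * (norm G)\<^sup>2) \<le> 1 * (\<mu> * (norm G)\<^sup>2)"
        using mu_bound mu by (intro mult_right_mono) (auto simp: N_def)
      then show ?thesis
        by (simp add: power_mult_distrib power2_eq_square mult_ac)
    qed
    ultimately show ?thesis
      by (simp add: distrib_left)
  qed
  finally have EQ: "expectation Q + \<mu> * (norm G)\<^sup>2 \<le> (1 + N ^ 4 * P * \<mu>\<^sup>2) * L z"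
    by (simp add: algebra_simps power2_eq_square power4_eq_xxxx)
  have Q_nonneg: "0 \<le> Q \<omega>" for \<omega>
    using LQ L order_trans by blast
  have "(\<integral>\<^sup>+\<omega>. ennreal (L (z - \<mu> *\<^sub>R g \<omega>)) \<partial>M) \<le> (\<integral>\<^sup>+\<omega>. ennreal (Q \<omega>) \<partial>M)"
    by (intro nn_integral_mono ennreal_leI LQ)
  also have "\<dots> = ennreal (expectation Q)"
    using Q_nonneg by (intro nn_integral_eq_integral Q_int) simp
  finally have "(\<integral>\<^sup>+\<omega>. ennreal (L (z - \<mu> *\<^sub>R g \<omega>)) \<partial>M) + ennreal (\<mu> * (norm G)\<^sup>2)
      \<le> ennreal (expectation Q) + ennreal (\<mu> * (norm G)\<^sup>2)"
    by (rule add_right_mono)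
  also have "\<dots> = ennreal (expectation Q + \<mu> * (norm G)\<^sup>2)"
    using Q_nonneg mu by (intro ennreal_plus[symmetric] integral_nonneg) auto
  also have "\<dots> \<le> ennreal ((1 + N ^ 4 * P * \<mu>\<^sup>2) * L z)"
    by (rule ennreal_leI[OF EQ])
  also have "\<dots> = ennreal (1 + N ^ 4 * P * \<mu>\<^sup>2) * ennreal (L z)"
    using N P L by (intro ennreal_mult) auto
  finally show ?thesis
    by (simp only: L_def G_def g_def N_def P_def)
qed

section \<open>Almost sure convergence of the gradients\<close>

theorem theorem3p9:
  fixes A :: "complex ^ 'd ^ 'm" and y :: "real ^ 'm" and \<epsilon> :: real
    and blk :: "'m \<Rightarrow> 'r::finite" and p :: "'r pmf" and K :: nat
    and M :: "'w measure" and r :: "nat \<Rightarrow> nat \<Rightarrow> 'w \<Rightarrow> 'r"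
    and \<mu> :: "nat \<Rightarrow> real" and z0 :: "complex ^ 'd"
    and z :: "nat \<Rightarrow> 'w \<Rightarrow> complex ^ 'd"
  assumes y_nonneg: "\<And>i. y $ i \<ge> 0"
    and eps_pos: "\<epsilon> > 0"
    and blocks_nonempty: "surj blk"
    and p_bounds: "\<And>b. 0 < pmf p b \<and> pmf p b < 1"
    and K_pos: "K \<ge> 1"
    and prob: "prob_space M"
    and indep: "prob_space.indep_vars M (\<lambda>_. count_space UNIV)
                  (\<lambda>(t, k). r t k) (UNIV \<times> {1..K})"
    and distr: "\<And>t k. k \<in> {1..K} \<Longrightarrow>
                  distr M (count_space UNIV) (r t k) = measure_pmf p"
    and start: "\<And>\<omega>. \<omega> \<in> space M \<Longrightarrow> z 0 \<omega> = z0"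
    and step: "\<And>t \<omega>. \<omega> \<in> space M \<Longrightarrow>
                 z (Suc t) \<omega> =
                   z t \<omega> - \<mu> t *\<^sub>R stoch_grad A y \<epsilon> blk p K (\<lambda>k. r t k \<omega>) (z t \<omega>)"
    and mu_pos: "\<And>t. \<mu> t > 0"
    and mu_sum: "filterlim (\<lambda>n. \<Sum>t<n. \<mu> t) at_top sequentially"
    and mu_sq_sum: "summable (\<lambda>t. (\<mu> t)\<^sup>2)"
    and mu_bound: "\<And>t. (1 - 1 / real K) * (onorm ((*v) A))\<^sup>2 * \<mu> t \<le> 1"
  shows "AE \<omega> in M. (\<lambda>t. norm (amp_grad A y \<epsilon> UNIV (z t \<omega>))) \<longlonglongrightarrow> 0"
proof -
  interpret prob_space M by (rule prob)
  have p: "0 < pmf p b" for b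
    using p_bounds by simp
  define L where "L = amp_loss A y \<epsilon> UNIV"
  define G where "G = amp_grad A y \<epsilon> UNIV"
  define g where "g = stoch_grad A y \<epsilon> blk p K"
  define N where "N = onorm ((*v) A)"
  define P where "P = (\<Sum>b\<in>UNIV. 1 / pmf p b)"
  define c where "c t = N ^ 4 * P * (\<mu> t)\<^sup>2" for t
  have N: "0 \<le> N"
    unfolding N_def by (rule onorm_pos_le[OF bounded_linear_complex_matrix_vector_mult])
  have P: "0 \<le> P"
    unfolding P_def by (intro sum_nonneg) (simp add: less_imp_le)
  have L: "0 \<le> L w" for w
    unfolding L_def by (rule amp_loss_nonneg)

  \<comment> \<open>\<open>U t\<close> collects the indices drawn before time \<open>t\<close>, \<open>V t\<close> those drawn at time \<open>t\<close>. Both take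
    finitely many values, so that every function of them is measurable.\<close>
  define J where "J t = {..<t} \<times> {1..K}" for t :: nat
  define U where "U t \<omega> = restrict (\<lambda>j. (case j of (s, k) \<Rightarrow> r s k) \<omega>) (J t)" for t \<omega>
  define V where "V t \<omega> = restrict (\<lambda>j. (case j of (s, k) \<Rightarrow> r s k) \<omega>) ({t} \<times> {1..K})" for t \<omega>
  define S where "S t = count_space (PiE (J t) (\<lambda>_. UNIV :: 'r set))" for t
  define F where "F t = vimage_algebra (space M) (U t) (S t)" for t
  have S_eq: "PiM (J t) (\<lambda>_. count_space UNIV) = S t" for t
    unfolding S_def by (rule count_space_PiM_finite) (auto simp: J_def)
  have T_eq: "PiM ({t} \<times> {1..K}) (\<lambda>_. count_space UNIV)
      = count_space (PiE ({t} \<times> {1..K}) (\<lambda>_. UNIV :: 'r set))" for t :: nat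
    by (rule count_space_PiM_finite) auto
  have UV: "indep_var (S t) (U t) (count_space (PiE ({t} \<times> {1..K}) (\<lambda>_. UNIV))) (V t)" for t
    unfolding S_eq[symmetric] T_eq[symmetric] U_def[abs_def] V_def[abs_def]
    by (rule indep_var_restrict[OF indep]) (auto simp: J_def)
  have U_meas: "U t \<in> measurable M (S t)" for t
    using UV[of t] by (rule indep_var_rv1)
  have U_space: "U t \<in> space M \<rightarrow> space (S t)" for t
    using measurable_space[OF U_meas] by auto
  have F_sets: "sets (F t) = {U t -` B \<inter> space M | B. B \<in> sets (S t)}" for t
    unfolding F_def by (rule sets_vimage_algebra2[OF U_space])
  have F_sub: "subalgebra M (F t)" for t
    unfolding subalgebra_def F_sets using measurable_sets[OF U_meas] by (auto simp: F_def)
  have F_mono: "sets (F t) \<subseteq> sets (F (Suc t))" for t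
  proof
    fix B assume "B \<in> sets (F t)"
    then obtain B' where B': "B = U t -` B' \<inter> space M"
      by (auto simp: F_sets)
    have "U t \<omega> = restrict (U (Suc t) \<omega>) (J t)" for \<omega>
      by (auto simp: U_def J_def fun_eq_iff restrict_def)
    then have "B = U (Suc t) -` {u \<in> space (S (Suc t)). restrict u (J t) \<in> B'} \<inter> space M"
      using U_space[of "Suc t"] by (auto simp: B')
    moreover have "{u \<in> space (S (Suc t)). restrict u (J t) \<in> B'} \<in> sets (S (Suc t))"
      by (auto simp: S_def)
    ultimately show "B \<in> sets (F (Suc t))"
      unfolding F_sets by blast
  qed
  \<comment> \<open>The iterate \<open>z\<^sub>t\<close> is a deterministic function of the past indices.\<close>
  have "\<exists>f. \<forall>\<omega>\<in>space M. z t \<omega> = f (U t \<omega>)" for t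
  proof (induction t)
    case 0
    then show ?case
      using start by (intro exI[of _ "\<lambda>_. z0"]) simp
  next
    case (Suc t)
    then obtain f where f: "\<And>\<omega>. \<omega> \<in> space M \<Longrightarrow> z t \<omega> = f (U t \<omega>)"
      by blast
    have "z (Suc t) \<omega> = (\<lambda>u. f (restrict u (J t)) - \<mu> t *\<^sub>R g (\<lambda>k. u (t, k)) (f (restrict u (J t)))) (U (Suc t) \<omega>)"
      if "\<omega> \<in> space M" for \<omega>
    proof -
      have past: "restrict (U (Suc t) \<omega>) (J t) = U t \<omega>"
        by (auto simp: U_def J_def fun_eq_iff restrict_def)
      have fresh: "g (\<lambda>k. U (Suc t) \<omega> (t, k)) w = g (\<lambda>k. r t k \<omega>) w" for w
        by (simp add: g_def stoch_grad_def U_def J_def)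
      show ?thesis
        unfolding past fresh f[OF that, symmetric] unfolding g_def by (rule step[OF that])
    qed
    then show ?case
      by (intro exI[of _ "\<lambda>u. f (restrict u (J t)) - \<mu> t *\<^sub>R g (\<lambda>k. u (t, k)) (f (restrict u (J t)))"] ballI)
  qed
  then obtain f where f: "\<And>t \<omega>. \<omega> \<in> space M \<Longrightarrow> z t \<omega> = f t (U t \<omega>)"
    by metis
  have F_borel: "(\<lambda>\<omega>. \<phi> (z t \<omega>)) \<in> borel_measurable (F t)" for t and \<phi> :: "complex ^ 'd \<Rightarrow> ennreal"
  proof -
    have "U t \<in> measurable (F t) (S t)"
      unfolding F_def by (rule measurable_vimage_algebra1[OF U_space])
    then have "(\<lambda>\<omega>. \<phi> (f t (U t \<omega>))) \<in> borel_measurable (F t)"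
      by (rule measurable_compose) (simp add: S_def)
    moreover have "\<phi> (z t \<omega>) = \<phi> (f t (U t \<omega>))" if "\<omega> \<in> space (F t)" for \<omega>
      using that f by (simp add: F_def)
    ultimately show ?thesis
      by (simp cong: measurable_cong)
  qed

  define X where "X t \<omega> = ennreal (L (z t \<omega>))" for t \<omega>
  define H where "H t \<omega> = ennreal (\<mu> t * (norm (G (z t \<omega>)))\<^sup>2)" for t \<omega>
  have X_meas: "X t \<in> borel_measurable (F t)" and H_meas: "H t \<in> borel_measurable (F t)" for t
    unfolding X_def[abs_def] H_def[abs_def] by (rule F_borel)+
  have drift: "(\<integral>\<^sup>+\<omega>\<in>B. X (Suc t) \<omega> \<partial>M) + (\<integral>\<^sup>+\<omega>\<in>B. H t \<omega> \<partial>M)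
      \<le> ennreal (1 + c t) * (\<integral>\<^sup>+\<omega>\<in>B. X t \<omega> \<partial>M)" if "B \<in> sets (F t)" for t B
  proof -
    obtain B' where B: "B = U t -` B' \<inter> space M"
      using \<open>B \<in> sets (F t)\<close> by (auto simp: F_sets)
    have B_M: "B \<in> sets M"
      using F_sub \<open>B \<in> sets (F t)\<close> by (auto simp: subalgebra_def)
    note XH_M[measurable] = measurable_from_subalg[OF F_sub X_meas] measurable_from_subalg[OF F_sub H_meas]
    \<comment> \<open>The next loss as a function of past and fresh indices, restricted to the event \<open>B\<close> of the past.\<close>
    define \<phi> where "\<phi> = (\<lambda>(u, v). ennreal (L (f t u - \<mu> t *\<^sub>R g (\<lambda>k. v (t, k)) (f t u))) * indicator B' u)"
    have \<phi>_meas: "\<phi> \<in> borel_measurable (S t \<Otimes>\<^sub>M count_space (PiE ({t} \<times> {1..K}) (\<lambda>_. UNIV)))"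
      unfolding S_def
      by (subst pair_measure_countable) (auto intro!: countable_finite finite_PiE simp: J_def)
    have gV: "g (\<lambda>k. V t \<omega> (t, k)) w = g (\<lambda>k. r t k \<omega>) w" for \<omega> w
      by (simp add: g_def stoch_grad_def V_def)
    have "(\<integral>\<^sup>+\<omega>\<in>B. X (Suc t) \<omega> \<partial>M) = (\<integral>\<^sup>+\<omega>. \<phi> (U t \<omega>, V t \<omega>) \<partial>M)"
      by (intro nn_integral_cong)
         (auto simp: X_def \<phi>_def B step f[symmetric] gV g_def[symmetric] indicator_def)
    also have "\<dots> = (\<integral>\<^sup>+\<omega>. (\<integral>\<^sup>+\<omega>'. \<phi> (U t \<omega>, V t \<omega>') \<partial>M) \<partial>M)"
      by (rule nn_integral_indep_var[OF UV \<phi>_meas])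
    also have "\<dots> = (\<integral>\<^sup>+\<omega>\<in>B. (\<integral>\<^sup>+\<omega>'. ennreal (L (z t \<omega> - \<mu> t *\<^sub>R g (\<lambda>k. r t k \<omega>') (z t \<omega>))) \<partial>M) \<partial>M)"
      by (intro nn_integral_cong)
         (auto simp: \<phi>_def B f[symmetric] gV indicator_def)
    finally have next_eq: "(\<integral>\<^sup>+\<omega>\<in>B. X (Suc t) \<omega> \<partial>M)
        = (\<integral>\<^sup>+\<omega>\<in>B. (\<integral>\<^sup>+\<omega>'. ennreal (L (z t \<omega> - \<mu> t *\<^sub>R g (\<lambda>k. r t k \<omega>') (z t \<omega>))) \<partial>M) \<partial>M)" .
    \<comment> \<open>The indices of a single time, relabelled from pairs \<open>(t, k)\<close> to \<open>k\<close>.\<close>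
    have now: "indep_vars (\<lambda>_. count_space UNIV) (\<lambda>k. r t k) {1..K}"
    proof -
      have "indep_vars (\<lambda>k. PiM {(t, k)} (\<lambda>_. count_space UNIV))
          (\<lambda>k \<omega>. restrict (\<lambda>j. (case j of (s, k) \<Rightarrow> r s k) \<omega>) {(t, k)}) {1..K}"
        by (rule indep_vars_restrict[OF indep]) (auto simp: disjoint_family_on_def)
      from indep_vars_compose2[OF this measurable_component_singleton[OF singletonI]] show ?thesis
        by simp
    qed
    have decrease: "(\<integral>\<^sup>+\<omega>'. ennreal (L (w - \<mu> t *\<^sub>R g (\<lambda>k. r t k \<omega>') w)) \<partial>M) + ennreal (\<mu> t * (norm (G w))\<^sup>2)
        \<le> ennreal (1 + c t) * ennreal (L w)" for w
      unfolding L_def g_def G_def c_def N_def P_def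
      by (rule expected_loss_decrease[OF y_nonneg eps_pos K_pos p now distr less_imp_le[OF mu_pos] mu_bound])
    have inner_meas: "(\<lambda>\<omega>. \<integral>\<^sup>+\<omega>'. ennreal (L (z t \<omega> - \<mu> t *\<^sub>R g (\<lambda>k. r t k \<omega>') (z t \<omega>))) \<partial>M) \<in> borel_measurable M"
      by (rule measurable_from_subalg[OF F_sub F_borel])
    have "(\<integral>\<^sup>+\<omega>\<in>B. X (Suc t) \<omega> \<partial>M) + (\<integral>\<^sup>+\<omega>\<in>B. H t \<omega> \<partial>M)
      = (\<integral>\<^sup>+\<omega>\<in>B. ((\<integral>\<^sup>+\<omega>'. ennreal (L (z t \<omega> - \<mu> t *\<^sub>R g (\<lambda>k. r t k \<omega>') (z t \<omega>))) \<partial>M) + H t \<omega>) \<partial>M)"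
      unfolding next_eq using B_M inner_meas
      by (subst nn_integral_add[symmetric]) (auto simp: distrib_right)
    also have "\<dots> \<le> (\<integral>\<^sup>+\<omega>\<in>B. (ennreal (1 + c t) * X t \<omega>) \<partial>M)"
      unfolding H_def X_def by (intro nn_integral_mono mult_right_mono decrease) simp
    also have "\<dots> = ennreal (1 + c t) * (\<integral>\<^sup>+\<omega>\<in>B. X t \<omega> \<partial>M)"
      using B_M by (subst nn_integral_cmult[symmetric]) (auto simp: mult.assoc)
    finally show ?thesis .
  qed
  have c_nonneg: "0 \<le> c t" for t
    unfolding c_def using N P by simp
  have c_sum: "summable c"
    unfolding c_def by (intro summable_mult mu_sq_sum)
  have init: "(\<integral>\<^sup>+\<omega>. X 0 \<omega> \<partial>M) < \<infinity>"
  proof -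
    have "(\<integral>\<^sup>+\<omega>. X 0 \<omega> \<partial>M) = (\<integral>\<^sup>+\<omega>. ennreal (L z0) \<partial>M)"
      by (intro nn_integral_cong) (simp add: X_def start)
    then show ?thesis
      by (simp add: emeasure_space_1)
  qed
  note rs = F_sub F_mono X_meas measurable_from_subalg[OF F_sub H_meas] c_nonneg c_sum drift init
  have weighted: "AE \<omega> in M. (\<Sum>t. H t \<omega>) < \<infinity>"
    by (rule almost_supermartingale_summable[OF rs])
  have bounded: "AE \<omega> in M. (SUP t. X t \<omega>) < \<infinity>"
    by (rule almost_supermartingale_bounded[OF rs])

  obtain C where C: "0 \<le> C" "\<And>w w'. norm (G w - G w') \<le> C * norm (w - w')"
    unfolding G_def using amp_grad_lipschitz[OF eps_pos, where A = A and y = y and S = UNIV] by metis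
  have mu_div: "\<not> summable \<mu>"
  proof
    assume "summable \<mu>"
    then have "(\<lambda>n. \<Sum>t<n. \<mu> t) \<longlonglongrightarrow> suminf \<mu>"
      by (rule summable_LIMSEQ)
    then show False
      using not_tendsto_and_filterlim_at_infinity[OF sequentially_bot _ filterlim_at_top_imp_at_infinity[OF mu_sum]]
      by blast
  qed
  show ?thesis
    using weighted bounded AE_space
  proof eventually_elim
    case (elim \<omega>)
    define b where "b = enn2real (SUP t. X t \<omega>)"
    have L_le: "L (z t \<omega>) \<le> b" for t
    proof -
      have "ennreal (L (z t \<omega>)) \<le> (SUP t. X t \<omega>)"
        unfolding X_def by (rule SUP_upper) simp
      also have "\<dots> = ennreal b"
        using elim(2) by (simp add: b_def)
      finally show ?thesis
        by (simp add: b_def)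
    qed
    show ?case
      unfolding G_def[symmetric]
    proof (rule tendsto_zero_if_weighted_squares_summable[OF norm_ge_zero less_imp_le[OF mu_pos] mu_div mu_sq_sum])
      show "summable (\<lambda>t. \<mu> t * (norm (G (z t \<omega>)))\<^sup>2)"
        using elim(1) mu_pos by (intro summable_suminf_not_top) (auto simp: H_def less_imp_le)
      show "\<bar>norm (G (z (Suc t) \<omega>)) - norm (G (z t \<omega>))\<bar> \<le> (C * (P * (N * sqrt b))) * \<mu> t" for t
      proof -
        have "\<bar>norm (G (z (Suc t) \<omega>)) - norm (G (z t \<omega>))\<bar> \<le> C * norm (z (Suc t) \<omega> - z t \<omega>)"
          by (rule order_trans[OF norm_triangle_ineq3 C(2)])
        also have "norm (z (Suc t) \<omega> - z t \<omega>) = \<mu> t * norm (g (\<lambda>k. r t k \<omega>) (z t \<omega>))"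
          using step[OF elim(3), of t] mu_pos[of t] by (simp add: g_def)
        also have "C * (\<mu> t * norm (g (\<lambda>k. r t k \<omega>) (z t \<omega>))) \<le> C * (\<mu> t * (P * (N * sqrt b)))"
        proof (intro mult_left_mono)
          have "norm (g (\<lambda>k. r t k \<omega>) (z t \<omega>)) \<le> P * (N * sqrt (L (z t \<omega>)))"
            unfolding g_def P_def N_def L_def by (rule norm_stoch_grad_le[OF eps_pos K_pos p])
          also have "\<dots> \<le> P * (N * sqrt b)"
            by (intro mult_left_mono real_sqrt_le_mono L_le N P)
          finally show "norm (g (\<lambda>k. r t k \<omega>) (z t \<omega>)) \<le> P * (N * sqrt b)" .
        qed (use C mu_pos in \<open>auto intro: less_imp_le\<close>)
        finally show ?thesis
          by (simp add: mult_ac)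
      qed
    qed
  qed
qed

end
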